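(* Let $A_1,\ldots,A_n\subset\mathbb{R}^n$ be finite nonempty sets of sizes $t_1,\ldots,t_n$, and let $\mathfrak{f}=(\mathfrak{f}_1,\ldots,\mathfrak{f}_n)$ be the system of $n$ random fewnomials $$\mathfrak{f}_k=\sum_{\alpha\in A_k}\mathfrak{f}_{k,\alpha}X^\alpha\qquad(k=1,\ldots,n),$$ where the $\mathfrak{f}_{k,\alpha}$ ($1\le k\le n$, $\alpha\in A_k$) are independent centered Gaussian random variables with arbitrary positive variances (no other restriction is placed on the variances). Then $$\mathbb{E}_{\mathfrak{f}}\,\#\mathcal{Z}(\mathfrak{f},\mathbb{R}^n_+)\le\frac{1}{4^n}\prod_{k=1}^n t_k(t_k-1).$$
   Context: $n\geq 1$ is an integer and $\mathbb{R}^n_+=\{x\in\mathbb{R}^n: x_i>0\text{ for all }i\}$. For $\alpha\in\mathbb{R}^n$ and $x\in\mathbb{R}^n_+$, $x^\alpha=\prod_{i=1}^n x_i^{\alpha_i}$. $\mathcal{Z}(\mathfrak{f},\mathbb{R}^n_+)$ is the set of $x\in\mathbb{R}^n_+$ with $\mathfrak{f}_1(x)=\cdots=\mathfrak{f}_n(x)=0$. *)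

theory Defs
  imports "HOL-Probability.Probability"
begin

definition pos_orthant :: "(real ^ 'n) set" where
  "pos_orthant = {x. \<forall>i. 0 < x $ i}"

definition power_product :: "real ^ 'n \<Rightarrow> real ^ 'n \<Rightarrow> real" where
  "power_product x \<alpha> = (\<Prod>i\<in>UNIV. (x $ i) powr (\<alpha> $ i))"

text \<open>The fewnomial with support \<open>A\<close> and coefficient \<open>c \<alpha>\<close> at the exponent \<open>\<alpha> \<in> A\<close>.
  It is only meaningful at points of \<^const>\<open>pos_orthant\<close>, since \<^const>\<open>powr\<close> is not
  the intended power at other arguments.\<close>

definition fewnomial :: "(real ^ 'n) set \<Rightarrow> (real ^ 'n \<Rightarrow> real) \<Rightarrow> real ^ 'n \<Rightarrow> real" where
  "fewnomial A c x = (\<Sum>\<alpha>\<in>A. c \<alpha> * power_product x \<alpha>)"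

definition pos_zeros :: "('n \<Rightarrow> real ^ 'n \<Rightarrow> real) \<Rightarrow> (real ^ 'n) set" where
  "pos_zeros f = {x \<in> pos_orthant. \<forall>k. f k x = 0}"

text \<open>Cardinality with value \<open>\<infinity>\<close> on infinite sets, where \<^const>\<open>card\<close> would give \<open>0\<close>.\<close>

definition num_elems :: "'a set \<Rightarrow> ennreal" where
  "num_elems S = emeasure (count_space UNIV) S"

end

theory Submission
  imports Defs
begin

text \<open>
  Substituting \<open>x = exp w\<close> turns each fewnomial into an exponential sum
  \<open>f(w) = \<Sum>\<alpha>. \<xi>\<^sub>\<alpha> m\<^sub>\<alpha>(w)\<close> with weights \<open>m\<^sub>\<alpha>(w) = \<sigma>\<^sub>\<alpha> exp(\<alpha> \<bullet> w)\<close> and independent standard normal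
  \<open>\<xi>\<^sub>\<alpha>\<close>. The zeros stay the same if \<open>f\<close> is divided by the norm \<open>L(w)\<close> of the weight vector. The
  gain is that the gradient of \<open>f / L\<close> is, at every point and not only at zeros, a combination of
  exponent differences
  \<open>1/2 \<Sum>\<alpha> \<beta>. (m\<^sub>\<alpha> m\<^sub>\<beta> / L^3) (m\<^sub>\<beta> \<xi>\<^sub>\<alpha> - m\<^sub>\<alpha> \<xi>\<^sub>\<beta>) (\<alpha> - \<beta>)\<close>,
  whose random coefficients are uncorrelated with the value \<open>f / L\<close>. This replaces the
  conditioning on \<open>f(w) = 0\<close> in the Kac-Rice formula.

  The number of zeros is bounded through Kac's counting integral
  \<open>(2 \<epsilon>)^(-n) \<integral> 1{|f\<^sub>k / L\<^sub>k| < \<epsilon> for all k} |det D(f / L)| dw\<close>: near a nondegenerate zero the map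
  covers a full cube of side \<open>2 \<epsilon>\<close>, so each such zero contributes at least \<open>1\<close> once \<open>\<epsilon>\<close> is
  small (\<open>kac_counting\<close>). Almost surely all zeros are nondegenerate. Indeed, dividing each
  equation by one of its monomials isolates a coefficient as a constant term, so that degenerate
  systems have vectors of constant terms that are critical values of a map depending on the other
  coefficients only; critical values are negligible by Sard's theorem
  (\<open>AE_zeros_nondegenerate\<close>).

  By Fatou's lemma and Fubini's theorem it remains to bound the expectation of the integrand for
  fixed \<open>w\<close>. Multilinearity expands the determinant into a sum over the choices of one ordered
  pair \<open>(\<alpha>\<^sub>k, \<beta>\<^sub>k)\<close> for every \<open>k\<close>, the rows are independent, and a rotation in the plane
  of \<open>(\<xi>\<^sub>\<alpha>, \<xi>\<^sub>\<beta>)\<close> bounds the factor of the row \<open>k\<close> by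
  \<open>\<epsilon>/\<pi> \<cdot> m\<^sub>\<alpha> m\<^sub>\<beta> / L^2 \<le> \<epsilon>/\<pi> \<cdot> m\<^sub>\<alpha> m\<^sub>\<beta> / (m\<^sub>\<alpha>^2 + m\<^sub>\<beta>^2)\<close>
  (\<open>expected_pair_term_le\<close>). The last quotient is \<open>1 / (exp y + exp (-y))\<close> where \<open>y\<close> is an affine
  function of \<open>w\<close> with linear part \<open>\<alpha>\<^sub>k - \<beta>\<^sub>k\<close>. The matrix of these linear parts is exactly the one
  whose determinant multiplies the term, so a linear substitution evaluates the integral over
  \<open>w\<close> as the product of \<open>n\<close> integrals \<open>\<integral> dy / (exp y + exp (-y)) = \<pi>/2\<close>. Every choice of pairs thus
  contributes at most \<open>(\<epsilon>/\<pi> \<cdot> \<pi>/2 / (2 \<epsilon>))^n = 1/4^n\<close>, and there are \<open>\<Prod>k. t\<^sub>k (t\<^sub>k - 1)\<close> choices with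
  \<open>\<alpha>\<^sub>k \<noteq> \<beta>\<^sub>k\<close>. In other words, the system has at most the expected number of zeros of all
  its binomial subsystems together.
\<close>

section \<open>Cardinality and measurability of zero sets\<close>

lemma disjoint_balls_around_finite_set:
  fixes S :: "'a::metric_space set"
  assumes "finite S"
  shows "\<exists>r>0. disjoint_family_on (\<lambda>x. ball x r) S"
proof -
  define D where "D = {dist x y |x y. x \<in> S \<and> y \<in> S \<and> x \<noteq> y}"
  have "D \<subseteq> (\<lambda>(x,y). dist x y) ` (S \<times> S)" by (auto simp: D_def)
  then have "finite D" using assms by (meson finite_SigmaI finite_imageI finite_subset)
  define r where "r = Min (insert 1 D) / 2"
  have "0 < Min (insert 1 D)" using \<open>finite D\<close> by (subst Min_gr_iff) (auto simp: D_def)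
  then have "r > 0" by (simp add: r_def)
  moreover have "ball x r \<inter> ball y r = {}" if "x \<in> S" "y \<in> S" "x \<noteq> y" for x y
  proof -
    have "dist x y \<in> D" using that by (auto simp: D_def)
    then have "2 * r \<le> dist x y" using \<open>finite D\<close> by (simp add: r_def)
    then show ?thesis
      by (metis (no_types, opaque_lifting) disjoint_ballI mult_2)
  qed
  ultimately show ?thesis unfolding disjoint_family_on_def by blast
qed

text \<open>This form treats finite and infinite \<open>Z\<close> alike: an infinite set has finite subsets of every size.\<close>

lemma num_elems_le:
  assumes "\<And>S. finite S \<Longrightarrow> S \<subseteq> Z \<Longrightarrow> of_nat (card S) \<le> L"
  shows "num_elems Z \<le> L"
proof (cases "finite Z")
  case True
  then show ?thesis using assms[of Z] by (simp add: num_elems_def emeasure_count_space)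
next
  case False
  have "of_nat n \<le> L" for n
    using infinite_arbitrarily_large[OF False, of n] assms by blast
  then have "L = \<top>"
    by (metis ennreal_of_nat_eq_real_of_nat ennreal_Ex_less_of_nat less_top leD)
  then show ?thesis by simp
qed

text \<open>By compactness a zero exists as soon as a continuous function takes arbitrarily small values, and
these can be looked for in a countable dense subset. The existential quantifier over an uncountable
set is thereby replaced by countable ones.\<close>

lemma pred_exists_zero_in_compact:
  fixes H :: "'a \<Rightarrow> 'b::euclidean_space \<Rightarrow> real"
  assumes K: "compact K" and cont: "\<And>\<omega>. \<omega> \<in> space M \<Longrightarrow> continuous_on K (H \<omega>)"
    and [measurable]: "\<And>w. (\<lambda>\<omega>. H \<omega> w) \<in> borel_measurable M"
  shows "Measurable.pred M (\<lambda>\<omega>. \<exists>w\<in>K. H \<omega> w = 0)"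
proof -
  obtain D where D: "countable D" "D \<subseteq> K" "K \<subseteq> closure D"
    using separable[of K] by blast
  have "(\<exists>w\<in>K. H \<omega> w = 0) \<longleftrightarrow> (\<forall>n::nat. \<exists>q\<in>D. \<bar>H \<omega> q\<bar> < inverse (Suc n))" if \<omega>: "\<omega> \<in> space M" for \<omega>
  proof
    assume "\<exists>w\<in>K. H \<omega> w = 0"
    then obtain w where w: "w \<in> K" "H \<omega> w = 0" by blast
    show "\<forall>n::nat. \<exists>q\<in>D. \<bar>H \<omega> q\<bar> < inverse (Suc n)"
    proof
      fix n :: nat
      obtain d where d: "d > 0" "\<And>q. q \<in> K \<Longrightarrow> dist q w < d \<Longrightarrow> dist (H \<omega> q) (H \<omega> w) < inverse (Suc n)"
        using cont[OF \<omega>] w(1) unfolding continuous_on_iff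
        by (metis inverse_positive_iff_positive of_nat_0_less_iff zero_less_Suc)
      obtain q where "q \<in> D" "dist q w < d"
        using D(3) w(1) d(1) by (meson closure_approachable subsetD)
      then show "\<exists>q\<in>D. \<bar>H \<omega> q\<bar> < inverse (Suc n)"
        using d(2)[of q] D(2) w(2) by (auto simp: dist_real_def)
    qed
  next
    assume *: "\<forall>n::nat. \<exists>q\<in>D. \<bar>H \<omega> q\<bar> < inverse (Suc n)"
    then have "K \<noteq> {}" using D(2) by auto
    moreover have "continuous_on K (\<lambda>w. \<bar>H \<omega> w\<bar>)" using cont[OF \<omega>] by (intro continuous_intros)
    ultimately obtain x where x: "x \<in> K" "\<And>y. y \<in> K \<Longrightarrow> \<bar>H \<omega> x\<bar> \<le> \<bar>H \<omega> y\<bar>"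
      using continuous_attains_inf[OF K] by blast
    have "\<bar>H \<omega> x\<bar> < inverse (Suc n)" for n
      using * x(2) D(2) by (meson le_less_trans subsetD)
    then have "H \<omega> x = 0" by (metis less_asym reals_Archimedean zero_less_abs_iff)
    then show "\<exists>w\<in>K. H \<omega> w = 0" using x(1) by blast
  qed
  then have "Measurable.pred M (\<lambda>\<omega>. \<exists>w\<in>K. H \<omega> w = 0) \<longleftrightarrow>
    Measurable.pred M (\<lambda>\<omega>. \<forall>n::nat. \<exists>q\<in>D. \<bar>H \<omega> q\<bar> < inverse (Suc n))"
    by (rule measurable_cong)
  also have "\<dots>"
    using D(1) by measurable
  finally show ?thesis .
qed

lemma pred_exists_zero_in_open:
  fixes H :: "'a \<Rightarrow> 'b::euclidean_space \<Rightarrow> real"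
  assumes U: "open U" and cont: "\<And>\<omega>. \<omega> \<in> space M \<Longrightarrow> continuous_on U (H \<omega>)"
    and meas: "\<And>w. (\<lambda>\<omega>. H \<omega> w) \<in> borel_measurable M"
  shows "Measurable.pred M (\<lambda>\<omega>. \<exists>w\<in>U. H \<omega> w = 0)"
proof -
  obtain C where C: "\<And>n::nat. compact (C n)" "\<And>n. C n \<subseteq> U" "\<Union>(range C) = U"
    using open_Union_compact_subsets[OF U] by metis
  have "(\<exists>w\<in>U. H \<omega> w = 0) \<longleftrightarrow> (\<exists>n. \<exists>w\<in>C n. H \<omega> w = 0)" for \<omega>
    using C(3) by blast
  moreover have "Measurable.pred M (\<lambda>\<omega>. \<exists>w\<in>C n. H \<omega> w = 0)" for n
    by (rule pred_exists_zero_in_compact[OF C(1) _ meas])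
       (use cont C(2) in \<open>blast intro: continuous_on_subset\<close>)
  ultimately show ?thesis by simp
qed

text \<open>Finitely many points of a metric space lie in disjoint basic open sets, and conversely disjoint
open sets that meet \<open>Z\<close> give distinct points of \<open>Z\<close>. For a countable basis this expresses the
cardinality as a countable supremum, which makes it measurable in a parameter on which \<open>Z\<close> depends.\<close>

lemma num_elems_eq_SUP_basis:
  fixes Z :: "'a::metric_space set"
  assumes B: "topological_basis B"
  shows "num_elems Z = (SUP \<F>\<in>{\<F>. finite \<F> \<and> \<F> \<subseteq> B \<and> disjoint \<F>}.
    (\<Sum>U\<in>\<F>. if \<exists>z\<in>U. z \<in> Z then 1 else 0))" (is "_ = (SUP \<F>\<in>?F. ?s \<F>)")
proof (rule antisym)
  show "num_elems Z \<le> (SUP \<F>\<in>?F. ?s \<F>)"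
  proof (rule num_elems_le)
    fix S assume S: "finite S" "S \<subseteq> Z"
    obtain r where r: "r > 0" "disjoint_family_on (\<lambda>x. ball x r) S"
      using disjoint_balls_around_finite_set[OF S(1)] by blast
    have "\<exists>U\<in>B. x \<in> U \<and> U \<subseteq> ball x r" for x
      using topological_basisE[OF B open_ball, of x x r] r(1) by auto
    then obtain U where U: "\<And>x. U x \<in> B" "\<And>x. x \<in> U x" "\<And>x. U x \<subseteq> ball x r"
      by metis
    have disj: "U x \<inter> U y = {}" if "x \<in> S" "y \<in> S" "x \<noteq> y" for x y
      using r(2) that U(3)[of x] U(3)[of y] unfolding disjoint_family_on_def by blast
    have inj: "inj_on U S"
      using disj U(2) by (metis disjoint_iff inj_onI)
    have "U ` S \<in> ?F"
      using S(1) U(1) disj by (auto simp: disjoint_def)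
    moreover have "?s (U ` S) = of_nat (card S)"
    proof -
      have "?s (U ` S) = (\<Sum>x\<in>S. if \<exists>z\<in>U x. z \<in> Z then 1 else 0)"
        by (simp add: sum.reindex[OF inj])
      also have "\<dots> = (\<Sum>x\<in>S. 1)"
        using S(2) U(2) by (intro sum.cong) auto
      finally show ?thesis by simp
    qed
    ultimately show "of_nat (card S) \<le> (SUP \<F>\<in>?F. ?s \<F>)"
      using SUP_upper[of "U ` S" ?F ?s] by simp
  qed
  show "(SUP \<F>\<in>?F. ?s \<F>) \<le> num_elems Z"
  proof (rule SUP_least)
    fix \<F> assume F: "\<F> \<in> ?F"
    define \<G> where "\<G> = {U\<in>\<F>. \<exists>z\<in>U. z \<in> Z}"
    have fin: "finite \<G>" using F by (simp add: \<G>_def)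
    have "\<forall>U\<in>\<G>. \<exists>z. z \<in> U \<and> z \<in> Z" by (auto simp: \<G>_def)
    from bchoice[OF this] obtain f where f: "\<And>U. U \<in> \<G> \<Longrightarrow> f U \<in> U \<and> f U \<in> Z"
      by blast
    have "inj_on f \<G>"
    proof (rule inj_onI)
      fix U V assume "U \<in> \<G>" "V \<in> \<G>" "f U = f V"
      moreover from this have "f U \<in> U \<inter> V" using f[of U] f[of V] by auto
      ultimately show "U = V" using F unfolding \<G>_def disjoint_def by blast
    qed
    then have "card (f ` \<G>) = card \<G>" by (rule card_image)
    moreover have "?s \<F> = of_nat (card \<G>)"
      using F by (simp add: \<G>_def sum.If_cases Int_def)
    ultimately have "?s \<F> = num_elems (f ` \<G>)"
      using fin by (simp add: num_elems_def emeasure_count_space)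
    also have "\<dots> \<le> num_elems Z"
      using f unfolding num_elems_def by (intro emeasure_mono) auto
    finally show "?s \<F> \<le> num_elems Z" .
  qed
qed

lemma borel_measurable_num_zeros:
  fixes H :: "'a \<Rightarrow> 'b::euclidean_space \<Rightarrow> real"
  assumes cont: "\<And>\<omega>. \<omega> \<in> space M \<Longrightarrow> continuous_on UNIV (H \<omega>)"
    and meas: "\<And>w. (\<lambda>\<omega>. H \<omega> w) \<in> borel_measurable M"
  shows "(\<lambda>\<omega>. num_elems {w. H \<omega> w = 0}) \<in> borel_measurable M"
proof -
  obtain B :: "'b set set" where B: "countable B" "topological_basis B"
    using ex_countable_basis by blast
  have "Measurable.pred M (\<lambda>\<omega>. \<exists>w\<in>U. H \<omega> w = 0)" if "U \<in> B" for U
    using that B(2) cont meas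
    by (intro pred_exists_zero_in_open) (auto intro: topological_basis_open continuous_on_subset)
  then have "(\<lambda>\<omega>. SUP \<F>\<in>{\<F>. finite \<F> \<and> \<F> \<subseteq> B \<and> disjoint \<F>}.
    (\<Sum>U\<in>\<F>. if \<exists>z\<in>U. H \<omega> z = 0 then 1 else 0 :: ennreal)) \<in> borel_measurable M"
    using countable_subset[OF _ countable_Collect_finite_subset[OF B(1)],
        of "{\<F>. finite \<F> \<and> \<F> \<subseteq> B \<and> disjoint \<F>}"]
    by (intro borel_measurable_SUP borel_measurable_sum measurable_If) auto
  then show ?thesis
    unfolding num_elems_eq_SUP_basis[OF B(2)] by simp
qed

section \<open>A lower bound for the volume near nondegenerate zeros\<close>

text \<open>The open mapping theorem provides a cube around \<open>0\<close> inside the image of the ball. The part of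
the ball that is mapped into the cube of side \<open>2 \<epsilon>\<close> therefore has that whole cube as its image, and
the volume of an image is at most the integral of the absolute Jacobian determinant.\<close>

lemma kac_inequality_near_zero:
  fixes G :: "real^'n::{finite,wellorder} \<Rightarrow> real^'n::_"
  assumes der: "\<And>w. (G has_derivative (\<lambda>h. J w *v h)) (at w)"
    and cont: "continuous_on UNIV J"
    and zero: "G z = 0" and nondeg: "det (J z) \<noteq> 0" and r: "0 < r"
  shows "\<exists>\<epsilon>0>0. \<forall>\<epsilon>. 0 < \<epsilon> \<and> \<epsilon> < \<epsilon>0 \<longrightarrow> ennreal ((2 * \<epsilon>) ^ CARD('n)) \<le>
    (\<integral>\<^sup>+w. indicator (ball z r) w * (indicator {w. \<forall>k. \<bar>G w $ k\<bar> < \<epsilon>} w * ennreal \<bar>det (J w)\<bar>) \<partial>lborel)"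
proof -
  have contG: "continuous_on UNIV G"
    using der by (meson continuous_at_imp_continuous_on has_derivative_continuous)
  obtain B where B: "J z ** B = mat 1"
    using nondeg by (meson invertible_def invertible_det_nz)
  have "G z \<in> interior (G ` ball z r)"
  proof (rule sussmann_open_mapping[of UNIV])
    show "(G has_derivative (*v) (J z)) (at z)" by (rule der)
    show "bounded_linear ((*v) B)" by (rule matrix_vector_mul_bounded_linear)
    show "(*v) (J z) \<circ> (*v) B = id"
      using B by (auto simp: fun_eq_iff matrix_vector_mul_assoc)
  qed (use contG r in auto)
  then obtain \<delta> where \<delta>: "\<delta> > 0" "ball 0 \<delta> \<subseteq> G ` ball z r"
    unfolding zero mem_interior by blast
  define Q where "Q \<epsilon> = {y::(real,'n) vec. \<forall>k. \<bar>y $ k\<bar> < \<epsilon>}" for \<epsilon>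
  have Qbox: "Q \<epsilon> = box (\<chi> k. -\<epsilon>) (\<chi> k. \<epsilon>)" for \<epsilon>
    by (auto simp: Q_def mem_box_cart abs_less_iff minus_less_iff)
  have Qvol: "measure lebesgue (Q \<epsilon>) = (2 * \<epsilon>) ^ CARD('n)" if "\<epsilon> > 0" for \<epsilon>
  proof -
    have "measure lebesgue (Q \<epsilon>) = measure lborel (box (\<chi> k. -\<epsilon>) (\<chi> k. \<epsilon>) :: (real,'n) vec set)"
      unfolding Qbox by (simp add: measure_completion)
    also have "\<dots> = (\<Prod>b\<in>Basis. (((\<chi> k. \<epsilon>) - (\<chi> k. -\<epsilon>)) :: (real,'n) vec) \<bullet> b)"
      by (subst measure_lborel_box_eq) (use that in \<open>auto simp: Basis_vec_def inner_axis\<close>)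
    also have "\<dots> = (\<Prod>b\<in>(Basis::(real,'n) vec set). 2 * \<epsilon>)"
      by (rule prod.cong) (auto simp: Basis_vec_def inner_axis)
    finally show ?thesis by simp
  qed
  have "ennreal ((2 * \<epsilon>) ^ CARD('n)) \<le>
    (\<integral>\<^sup>+w. indicator (ball z r) w * (indicator {w. \<forall>k. \<bar>G w $ k\<bar> < \<epsilon>} w * ennreal \<bar>det (J w)\<bar>) \<partial>lborel)"
    if \<epsilon>: "0 < \<epsilon>" "\<epsilon> < \<delta> / CARD('n)" for \<epsilon>
  proof -
    have "Q \<epsilon> \<subseteq> ball 0 \<delta>"
    proof
      fix y assume y: "y \<in> Q \<epsilon>"
      have "norm y \<le> (\<Sum>k\<in>UNIV. \<bar>y $ k\<bar>)" by (rule norm_le_l1_cart)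
      also have "\<dots> \<le> (\<Sum>k\<in>(UNIV::'n set). \<epsilon>)"
        using y by (intro sum_mono) (auto simp: Q_def less_imp_le)
      also have "\<dots> < \<delta>" using \<epsilon> by (simp add: field_simps)
      finally show "y \<in> ball 0 \<delta>" by simp
    qed
    define S where "S = ball z r \<inter> G -` Q \<epsilon>"
    have GS: "G ` S = Q \<epsilon>"
      using \<delta> \<open>Q \<epsilon> \<subseteq> ball 0 \<delta>\<close> unfolding S_def by blast
    have openS: "open S"
      unfolding S_def Qbox by (intro open_Int open_ball open_vimage open_box contG)
    have contdet: "continuous_on UNIV (\<lambda>w. \<bar>det (J w)\<bar>)"
      unfolding det_def
      by (intro continuous_intros continuous_on_component cont)
    have "set_integrable lborel (cball z r) (\<lambda>w. \<bar>det (J w)\<bar>)"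
      unfolding set_integrable_def
      using contdet by (intro borel_integrable_compact) (auto intro: continuous_on_subset)
    then have int: "set_integrable lborel S (\<lambda>w. \<bar>det (J w)\<bar>)"
      by (rule set_integrable_subset) (use openS in \<open>auto simp: S_def\<close>)
    have "(2 * \<epsilon>) ^ CARD('n) \<le> integral S (\<lambda>w. \<bar>det (matrix ((*v) (J w)))\<bar>)"
      unfolding Qvol[OF \<epsilon>(1), symmetric] GS[symmetric]
    proof (rule measure_differentiable_image)
      show "S \<in> sets lebesgue" using openS by (auto intro!: lborelD borel_open)
      show "(\<lambda>x. \<bar>det (matrix ((*v) (J x)))\<bar>) integrable_on S"
        using set_borel_integral_eq_integral(1)[OF int] by simp
    qed (use der in \<open>auto intro: has_derivative_at_withinI\<close>)
    also have "\<dots> = (LINT w:S|lborel. \<bar>det (J w)\<bar>)"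
      using set_borel_integral_eq_integral(2)[OF int] by simp
    finally have "ennreal ((2 * \<epsilon>) ^ CARD('n)) \<le> ennreal (LINT w:S|lborel. \<bar>det (J w)\<bar>)"
      by (rule ennreal_leI)
    also have "\<dots> = (\<integral>\<^sup>+w. ennreal (indicator S w * \<bar>det (J w)\<bar>) \<partial>lborel)"
      unfolding set_lebesgue_integral_def
      by (subst nn_integral_eq_integral) (use int in \<open>auto simp: set_integrable_def\<close>)
    also have "\<dots> = (\<integral>\<^sup>+w. indicator (ball z r) w * (indicator {w. \<forall>k. \<bar>G w $ k\<bar> < \<epsilon>} w * ennreal \<bar>det (J w)\<bar>) \<partial>lborel)"
      by (rule nn_integral_cong) (auto simp: S_def Q_def indicator_def)
    finally show ?thesis .
  qed
  then show ?thesis using \<delta>(1) by (intro exI[of _ "\<delta> / CARD('n)"]) auto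
qed

text \<open>For small \<open>\<epsilon>\<close>, disjoint balls around finitely many zeros contribute at least one cube volume
each. Letting the finite set of zeros grow covers infinite zero sets as well.\<close>

lemma kac_counting:
  fixes G :: "real^'n::{finite,wellorder} \<Rightarrow> real^'n::_"
  assumes der: "\<And>w. (G has_derivative (\<lambda>h. J w *v h)) (at w)"
    and cont: "continuous_on UNIV J"
    and nondeg: "\<And>z. G z = 0 \<Longrightarrow> det (J z) \<noteq> 0"
    and \<epsilon>: "\<And>j. 0 < \<epsilon> j" "\<epsilon> \<longlonglongrightarrow> 0"
  shows "num_elems {z. G z = 0} \<le> liminf (\<lambda>j.
    (\<integral>\<^sup>+w. indicator {w. \<forall>k. \<bar>G w $ k\<bar> < \<epsilon> j} w * ennreal \<bar>det (J w)\<bar> \<partial>lborel) / ennreal ((2 * \<epsilon> j) ^ CARD('n)))"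
    (is "_ \<le> liminf (\<lambda>j. ?I j / ?V j)")
proof (rule num_elems_le)
  fix S assume S: "finite S" "S \<subseteq> {z. G z = 0}"
  let ?f = "\<lambda>\<epsilon> w. indicator {w. \<forall>k. \<bar>G w $ k\<bar> < \<epsilon>} w * ennreal \<bar>det (J w)\<bar>"
  obtain r where r: "r > 0" "disjoint_family_on (\<lambda>x. ball x r) S"
    using disjoint_balls_around_finite_set[OF S(1)] by blast
  have contG: "continuous_on UNIV G"
    using der by (meson continuous_at_imp_continuous_on has_derivative_continuous)
  have G_meas [measurable]: "(\<lambda>w. G w $ k) \<in> borel_measurable borel" for k
    by (intro borel_measurable_continuous_onI continuous_on_component contG)
  have J_meas [measurable]: "(\<lambda>w. det (J w)) \<in> borel_measurable borel"
    unfolding det_def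
    by (intro borel_measurable_continuous_onI continuous_intros continuous_on_component cont)
  have f_meas: "?f e \<in> borel_measurable borel" for e
    by measurable
  have "\<forall>z\<in>S. \<exists>\<epsilon>0>0. \<forall>\<epsilon>. 0 < \<epsilon> \<and> \<epsilon> < \<epsilon>0 \<longrightarrow> ennreal ((2 * \<epsilon>) ^ CARD('n)) \<le>
    (\<integral>\<^sup>+w. indicator (ball z r) w * ?f \<epsilon> w \<partial>lborel)"
    using S(2) by (intro ballI kac_inequality_near_zero[OF der cont _ nondeg r(1)]) auto
  from bchoice[OF this] obtain e0 where e0: "\<And>z. z \<in> S \<Longrightarrow> e0 z > 0"
    "\<And>z \<epsilon>. z \<in> S \<Longrightarrow> 0 < \<epsilon> \<Longrightarrow> \<epsilon> < e0 z \<Longrightarrow> ennreal ((2 * \<epsilon>) ^ CARD('n)) \<le>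
    (\<integral>\<^sup>+w. indicator (ball z r) w * ?f \<epsilon> w \<partial>lborel)"
    by blast
  \<comment> \<open>The threshold depends on the zero, but finitely many thresholds have a common tail.\<close>
  have "eventually (\<lambda>j. \<forall>z\<in>S. \<epsilon> j < e0 z) sequentially"
    by (rule eventually_ball_finite[OF S(1)]) (use e0(1) order_tendstoD(2)[OF \<epsilon>(2)] in blast)
  then have "eventually (\<lambda>j. of_nat (card S) \<le> ?I j / ?V j) sequentially"
  proof eventually_elim
    case (elim j)
    have "of_nat (card S) * ?V j = (\<Sum>z\<in>S. ?V j)" by simp
    also have "\<dots> \<le> (\<Sum>z\<in>S. \<integral>\<^sup>+w. indicator (ball z r) w * ?f (\<epsilon> j) w \<partial>lborel)"
      by (rule sum_mono, rule e0(2)) (use elim \<epsilon>(1) in auto)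
    also have "\<dots> = (\<integral>\<^sup>+w. (\<Sum>z\<in>S. indicator (ball z r) w * ?f (\<epsilon> j) w) \<partial>lborel)"
      by (rule nn_integral_sum[symmetric]) (auto intro!: borel_measurable_times_ennreal borel_measurable_indicator f_meas)
    also have "\<dots> = (\<integral>\<^sup>+w. (\<Sum>z\<in>S. indicator (ball z r) w) * ?f (\<epsilon> j) w \<partial>lborel)"
      unfolding sum_distrib_right ..
    also have "\<dots> = (\<integral>\<^sup>+w. indicator (\<Union>z\<in>S. ball z r) w * ?f (\<epsilon> j) w \<partial>lborel)"
      unfolding indicator_UN_disjoint[OF S(1) r(2)] ..
    also have "\<dots> \<le> ?I j"
      by (intro nn_integral_mono) (simp add: indicator_def)
    finally have *: "of_nat (card S) * ?V j \<le> ?I j" .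
    have "?V j \<noteq> 0" "?V j \<noteq> \<top>" using \<epsilon>(1)[of j] by auto
    then have "of_nat (card S) = of_nat (card S) * ?V j / ?V j"
      by (simp add: ennreal_mult_divide_eq)
    also have "\<dots> \<le> ?I j / ?V j" by (rule divide_right_mono_ennreal[OF *])
    finally show ?case .
  qed
  then show "of_nat (card S) \<le> liminf (\<lambda>j. ?I j / ?V j)"
    by (rule Liminf_bounded)
qed

section \<open>Gaussian measures and independence\<close>

lemma nn_integral_abs_mult_gaussian:
  assumes "r > 0"
  shows "(\<integral>\<^sup>+v. ennreal (\<bar>v\<bar> * exp (- v\<^sup>2 / (2 * r))) \<partial>lborel) = ennreal (2 * r)"
proof -
  have "(\<integral>\<^sup>+v. ennreal (\<bar>v\<bar> * exp (- v\<^sup>2 / (2 * r))) \<partial>lborel) =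
    ennreal (sqrt r) * (\<integral>\<^sup>+x. ennreal (\<bar>sqrt r * x\<bar> * exp (- (sqrt r * x)\<^sup>2 / (2 * r))) \<partial>lborel)"
    using assms by (subst nn_integral_real_affine[where c="sqrt r" and t=0]) auto
  also have "(\<integral>\<^sup>+x. ennreal (\<bar>sqrt r * x\<bar> * exp (- (sqrt r * x)\<^sup>2 / (2 * r))) \<partial>lborel) =
    (\<integral>\<^sup>+x. ennreal (sqrt r * sqrt (2 * pi)) * ennreal (std_normal_density x * \<bar>x\<bar>) \<partial>lborel)"
    using assms by (intro nn_integral_cong)
      (auto simp: std_normal_density_def abs_mult power_mult_distrib ennreal_mult'[symmetric] mult_ac)
  also have "\<dots> = ennreal (sqrt r * sqrt (2 * pi)) * (\<integral>\<^sup>+x. ennreal (std_normal_density x * \<bar>x\<bar>) \<partial>lborel)"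
    by (rule nn_integral_cmult) simp
  also have "(\<integral>\<^sup>+x. ennreal (std_normal_density x * \<bar>x\<bar>) \<partial>lborel) = ennreal (sqrt (2 / pi))"
    using std_normal_moment_abs_odd[of 0]
    by (subst nn_integral_eq_integral) (auto simp: has_bochner_integral_iff)
  also have "ennreal (sqrt r) * (ennreal (sqrt r * sqrt (2 * pi)) * ennreal (sqrt (2 / pi))) =
    ennreal ((sqrt r * sqrt r) * (sqrt (2 * pi) * sqrt (2 / pi)))"
    using assms by (simp add: ennreal_mult[symmetric] mult_ac)
  also have "(sqrt r * sqrt r) * (sqrt (2 * pi) * sqrt (2 / pi)) = 2 * r"
    using assms by (simp add: real_sqrt_mult[symmetric])
  finally show ?thesis .
qed

text \<open>The coordinates \<open>u = p a + q b\<close> and \<open>v = q a - p b\<close> are a rotation of \<open>(a, b)\<close> scaled by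
\<open>N = p^2 + q^2\<close> (in area), so the standard Gaussian weight factors into a function of \<open>u\<close> and a function
of \<open>v\<close>. The slab condition only concerns \<open>u\<close> and the absolute value only \<open>v\<close>; the scaling cancels,
and the bound is uniform in the offset \<open>R\<close>.\<close>

lemma gaussian_pair_slab_bound:
  fixes p q R d :: real
  assumes p: "p > 0" and q: "q > 0" and d: "d > 0"
  shows "(\<integral>\<^sup>+b. \<integral>\<^sup>+a. indicator {..<d} \<bar>p * a + q * b + R\<bar> * ennreal \<bar>q * a - p * b\<bar>
     \<partial>density lborel std_normal_density \<partial>density lborel std_normal_density) \<le> ennreal (2 * d / pi)" (is "?I \<le> _")
proof -
  define N where "N = p\<^sup>2 + q\<^sup>2"
  have N: "N > 0" using p by (simp add: N_def sum_power2_gt_zero_iff)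
  define h where "h a b = indicator {..<d} \<bar>p * a + q * b + R\<bar> * ennreal \<bar>q * a - p * b\<bar> *
      ennreal (std_normal_density a * std_normal_density b)" for a b
  have [measurable]: "(\<lambda>x. h (f x) (g x)) \<in> borel_measurable X"
    if [measurable]: "f \<in> borel_measurable X" "g \<in> borel_measurable X" for f g and X :: "'b measure"
    unfolding h_def by measurable
  have h_rotated: "h ((p * u + q * v) / N) ((q * u - p * v) / N) =
     indicator {..<d} \<bar>u + R\<bar> * ennreal (1 / (2 * pi) * exp (- u\<^sup>2 / (2 * N))) * ennreal (\<bar>v\<bar> * exp (- v\<^sup>2 / (2 * N)))"
    for u v
  proof -
    define a b where "a = (p * u + q * v) / N" and "b = (q * u - p * v) / N"
    have "p * a + q * b = (p\<^sup>2 + q\<^sup>2) * u / N" "q * a - p * b = (p\<^sup>2 + q\<^sup>2) * v / N"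
      unfolding a_def b_def by (simp_all add: add_divide_distrib[symmetric] diff_divide_distrib[symmetric] power2_eq_square algebra_simps)
    then have *: "p * a + q * b = u" "q * a - p * b = v"
      using N by (auto simp flip: N_def)
    have "a\<^sup>2 + b\<^sup>2 = (p\<^sup>2 + q\<^sup>2) * (u\<^sup>2 + v\<^sup>2) / N\<^sup>2"
      unfolding a_def b_def
      by (simp add: power_divide add_divide_distrib[symmetric]) (simp add: power2_eq_square algebra_simps)
    then have ab: "a\<^sup>2 + b\<^sup>2 = (u\<^sup>2 + v\<^sup>2) / N"
      using N unfolding N_def[symmetric] by (simp add: power2_eq_square)
    have "std_normal_density a * std_normal_density b = 1 / (2 * pi) * exp (- (a\<^sup>2 + b\<^sup>2) / 2)"
      by (simp add: std_normal_density_def mult_exp_exp add_divide_distrib real_sqrt_mult[symmetric])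
    also have "\<dots> = 1 / (2 * pi) * exp (- u\<^sup>2 / (2 * N)) * exp (- v\<^sup>2 / (2 * N))"
      unfolding ab by (simp add: mult_exp_exp add_divide_distrib mult.commute)
    finally have dens: "std_normal_density a * std_normal_density b = 1 / (2 * pi) * exp (- u\<^sup>2 / (2 * N)) * exp (- v\<^sup>2 / (2 * N))" .
    have regroup: "x * ennreal \<bar>v\<bar> * ennreal (A * B) = x * ennreal A * ennreal (\<bar>v\<bar> * B)"
      if "0 \<le> A" "0 \<le> B" for x and A B :: real
      using that by (simp add: ennreal_mult mult_ac)
    show ?thesis
      unfolding a_def[symmetric] b_def[symmetric] h_def * dens by (rule regroup) auto
  qed
  have "(\<integral>\<^sup>+b. \<integral>\<^sup>+a. indicator {..<d} \<bar>p * a + q * b + R\<bar> * ennreal \<bar>q * a - p * b\<bar>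
     \<partial>density lborel std_normal_density \<partial>density lborel std_normal_density) =
     (\<integral>\<^sup>+b. \<integral>\<^sup>+a. h a b \<partial>lborel \<partial>lborel)"
    by (simp add: nn_integral_density h_def nn_integral_cmult[symmetric] ennreal_mult' mult_ac)
  \<comment> \<open>The change to \<open>(u, v)\<close> is done by two one-dimensional substitutions: first \<open>a\<close> is replaced by
    \<open>u\<close> for fixed \<open>b\<close>, then \<open>b\<close> by \<open>v\<close> for fixed \<open>u\<close>.\<close>
  also have "\<dots> = (\<integral>\<^sup>+b. ennreal (1 / p) * (\<integral>\<^sup>+u. h (- (q * b / p) + 1 / p * u) b \<partial>lborel) \<partial>lborel)"
  proof (rule nn_integral_cong)
    fix b
    show "(\<integral>\<^sup>+a. h a b \<partial>lborel) = ennreal (1 / p) * (\<integral>\<^sup>+u. h (- (q * b / p) + 1 / p * u) b \<partial>lborel)"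
      using p by (subst nn_integral_real_affine[where c="1/p" and t="- (q * b / p)"]) auto
  qed
  also have "\<dots> = ennreal (1 / p) * (\<integral>\<^sup>+u. \<integral>\<^sup>+b. h (- (q * b / p) + 1 / p * u) b \<partial>lborel \<partial>lborel)"
    by (subst lborel_pair.Fubini') (auto simp: nn_integral_cmult)
  also have "(\<integral>\<^sup>+u. \<integral>\<^sup>+b. h (- (q * b / p) + 1 / p * u) b \<partial>lborel \<partial>lborel) =
     (\<integral>\<^sup>+u. ennreal (p / N) * (\<integral>\<^sup>+v. h ((p * u + q * v) / N) ((q * u - p * v) / N) \<partial>lborel) \<partial>lborel)"
  proof (rule nn_integral_cong)
    fix u
    have sub: "- (q * (q * u / N + - p / N * v) / p) + 1 / p * u = (p * u + q * v) / N"
      "q * u / N + - p / N * v = (q * u - p * v) / N" for v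
    proof -
      show "q * u / N + - p / N * v = (q * u - p * v) / N" by (simp add: diff_divide_distrib)
      have "- (q * (q * u / N + - p / N * v) / p) + 1 / p * u = ((N - q\<^sup>2) * u + q * p * v) / (p * N)"
        using p N by (simp add: field_simps power2_eq_square)
      also have "N - q\<^sup>2 = p * p" by (simp add: N_def power2_eq_square)
      finally show "- (q * (q * u / N + - p / N * v) / p) + 1 / p * u = (p * u + q * v) / N"
        using p N by (simp add: field_simps)
    qed
    have "(\<integral>\<^sup>+b. h (- (q * b / p) + 1 / p * u) b \<partial>lborel) =
      ennreal \<bar>- p / N\<bar> * (\<integral>\<^sup>+v. h (- (q * (q * u / N + - p / N * v) / p) + 1 / p * u) (q * u / N + - p / N * v) \<partial>lborel)"
      using p N by (intro nn_integral_real_affine) auto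
    then show "(\<integral>\<^sup>+b. h (- (q * b / p) + 1 / p * u) b \<partial>lborel) =
      ennreal (p / N) * (\<integral>\<^sup>+v. h ((p * u + q * v) / N) ((q * u - p * v) / N) \<partial>lborel)"
      using p N unfolding sub(1) unfolding sub(2) by simp
  qed
  also have "\<dots> = ennreal (p / N) * (\<integral>\<^sup>+u. \<integral>\<^sup>+v. h ((p * u + q * v) / N) ((q * u - p * v) / N) \<partial>lborel \<partial>lborel)"
    by (rule nn_integral_cmult) measurable
  finally have reduced: "?I = ennreal (1 / p) * (ennreal (p / N) * (\<integral>\<^sup>+u. \<integral>\<^sup>+v. h ((p * u + q * v) / N) ((q * u - p * v) / N) \<partial>lborel \<partial>lborel))" .
  have "(\<integral>\<^sup>+u. \<integral>\<^sup>+v. h ((p * u + q * v) / N) ((q * u - p * v) / N) \<partial>lborel \<partial>lborel) =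
    (\<integral>\<^sup>+u. indicator {..<d} \<bar>u + R\<bar> * ennreal (1 / (2 * pi) * exp (- u\<^sup>2 / (2 * N))) * ennreal (2 * N) \<partial>lborel)"
    unfolding h_rotated
    by (simp only: nn_integral_abs_mult_gaussian[OF N, symmetric]) (simp add: nn_integral_cmult)
  also have "\<dots> \<le> (\<integral>\<^sup>+u. ennreal (N / pi) * indicator {- R - d<..<- R + d} u \<partial>lborel)"
  proof (rule nn_integral_mono)
    fix u
    have "exp (- u\<^sup>2 / (2 * N)) \<le> 1" using N by simp
    then have "1 / (2 * pi) * exp (- u\<^sup>2 / (2 * N)) * (2 * N) \<le> N / pi"
      using N by (simp add: field_simps)
    then have "ennreal (1 / (2 * pi) * exp (- u\<^sup>2 / (2 * N))) * ennreal (2 * N) \<le> ennreal (N / pi)"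
      using N by (simp add: ennreal_mult'[symmetric] ennreal_leI)
    then show "indicator {..<d} \<bar>u + R\<bar> * ennreal (1 / (2 * pi) * exp (- u\<^sup>2 / (2 * N))) * ennreal (2 * N)
      \<le> ennreal (N / pi) * indicator {- R - d<..<- R + d} u"
      by (auto simp: indicator_def)
  qed
  also have "\<dots> = ennreal (N / pi) * ennreal (2 * d)"
    using d by (simp add: nn_integral_cmult_indicator)
  finally have "?I \<le> ennreal (1 / p) * (ennreal (p / N) * (ennreal (N / pi) * ennreal (2 * d)))"
    unfolding reduced by (intro mult_left_mono) auto
  also have "\<dots> = ennreal (2 * d / pi)"
    using p N d by (simp add: ennreal_mult'[symmetric])
  finally show ?thesis .
qed

text \<open>A special case of grouping an independent family into disjoint blocks, here singletons.\<close>

lemma (in prob_space) indep_vars_reindex: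
  assumes X: "indep_vars (\<lambda>_. N) X I" and f: "inj_on f J" "f ` J \<subseteq> I"
  shows "indep_vars (\<lambda>_. N) (\<lambda>j. X (f j)) J"
proof -
  have "indep_vars (\<lambda>j. PiM {f j} (\<lambda>_. N)) (\<lambda>j \<omega>. \<lambda>i\<in>{f j}. X i \<omega>) J"
    by (rule indep_vars_restrict[OF X]) (use f in \<open>auto simp: disjoint_family_on_def inj_on_def\<close>)
  from indep_vars_compose2[OF this, of "\<lambda>j x. x (f j)" "\<lambda>_. N"] show ?thesis
    by (simp add: measurable_component_singleton)
qed

text \<open>Conditionally on all variables except \<open>X \<alpha>\<close> and \<open>X \<beta>\<close> the sum is \<open>m \<alpha> X \<alpha> + m \<beta> X \<beta>\<close> plus a constant
offset, so that the bound for a Gaussian pair applies uniformly and survives the outer integration.\<close>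

lemma (in prob_space) gaussian_slab_pair_bound:
  fixes X :: "'e \<Rightarrow> 'a \<Rightarrow> real"
  assumes T: "finite T" "\<alpha> \<in> T" "\<beta> \<in> T" "\<alpha> \<noteq> \<beta>" and m: "0 < m \<alpha>" "0 < m \<beta>" and d: "0 < d"
    and ind: "indep_vars (\<lambda>_. borel) X T"
    and X: "\<And>\<gamma>. \<gamma> \<in> T \<Longrightarrow> distributed M lborel (X \<gamma>) std_normal_density"
  shows "(\<integral>\<^sup>+\<omega>. indicator {..<d} \<bar>\<Sum>\<gamma>\<in>T. X \<gamma> \<omega> * m \<gamma>\<bar> * ennreal \<bar>m \<beta> * X \<alpha> \<omega> - m \<alpha> * X \<beta> \<omega>\<bar> \<partial>M)
     \<le> ennreal (2 * d / pi)"
proof -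
  let ?\<mu> = "density lborel std_normal_density"
  define f where "f x = indicator {..<d} \<bar>\<Sum>\<gamma>\<in>T. x \<gamma> * m \<gamma>\<bar> * ennreal \<bar>m \<beta> * x \<alpha> - m \<alpha> * x \<beta>\<bar>" for x
  define R where "R = T - {\<alpha>, \<beta>}"
  have TR: "T = insert \<alpha> (insert \<beta> R)" "\<alpha> \<notin> insert \<beta> R" "\<beta> \<notin> R" "finite R"
    using T by (auto simp: R_def)
  have f_meas: "f \<in> borel_measurable (PiM T (\<lambda>_. borel))"
  proof -
    have [measurable]: "(\<lambda>x. x \<gamma>) \<in> borel_measurable (PiM T (\<lambda>_. borel :: real measure))" if "\<gamma> \<in> T" for \<gamma>
      using that by (rule measurable_component_singleton)
    have [measurable]: "(\<lambda>x. \<Sum>\<gamma>\<in>T. x \<gamma> * m \<gamma>) \<in> borel_measurable (PiM T (\<lambda>_. borel :: real measure))"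
      by (intro borel_measurable_sum) measurable
    show ?thesis
      unfolding f_def using T(2,3) by measurable
  qed
  have f_meas': "f \<in> borel_measurable (PiM (insert \<alpha> (insert \<beta> R)) (\<lambda>_. ?\<mu>))"
    using f_meas unfolding TR(1) by (simp cong: measurable_cong_sets sets_PiM_cong)
  have X_meas: "X \<gamma> \<in> borel_measurable M" if "\<gamma> \<in> T" for \<gamma>
    using distributed_measurable[OF X[OF that]] by simp
  have X_restrict: "(\<lambda>\<omega>. \<lambda>\<gamma>\<in>T. X \<gamma> \<omega>) \<in> M \<rightarrow>\<^sub>M PiM T (\<lambda>_. borel)"
    by (rule measurable_restrict) (rule X_meas)
  have distr_X: "distr M borel (X \<gamma>) = ?\<mu>" if "\<gamma> \<in> T" for \<gamma>
    using distributed_distr_eq_density[OF X[OF that]] by (metis distr_cong sets_lborel)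
  have "distr M (PiM T (\<lambda>_. borel)) (\<lambda>\<omega>. \<lambda>\<gamma>\<in>T. X \<gamma> \<omega>) = PiM T (\<lambda>\<gamma>. distr M borel (X \<gamma>))"
    using indep_vars_iff_distr_eq_PiM'[of T X "\<lambda>_. borel"] ind X_meas T(2) by auto
  also have "\<dots> = PiM T (\<lambda>_. ?\<mu>)"
    by (rule PiM_cong) (auto simp: distr_X)
  finally have law: "distr M (PiM T (\<lambda>_. borel)) (\<lambda>\<omega>. \<lambda>\<gamma>\<in>T. X \<gamma> \<omega>) = PiM T (\<lambda>_. ?\<mu>)" .
  interpret \<mu>: prob_space ?\<mu> by (rule prob_space_normal_density) simp
  interpret product_prob_space "\<lambda>_. ?\<mu>" ..
  have "(\<integral>\<^sup>+\<omega>. indicator {..<d} \<bar>\<Sum>\<gamma>\<in>T. X \<gamma> \<omega> * m \<gamma>\<bar> * ennreal \<bar>m \<beta> * X \<alpha> \<omega> - m \<alpha> * X \<beta> \<omega>\<bar> \<partial>M)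
     = (\<integral>\<^sup>+\<omega>. f (\<lambda>\<gamma>\<in>T. X \<gamma> \<omega>) \<partial>M)"
    using T(2,3) by (simp add: f_def)
  also have "\<dots> = (\<integral>\<^sup>+x. f x \<partial>PiM T (\<lambda>_. ?\<mu>))"
    unfolding law[symmetric]
    by (rule nn_integral_distr[OF X_restrict, symmetric]) (simp add: f_meas)
  also have "\<dots> = (\<integral>\<^sup>+x. \<integral>\<^sup>+a. f (x(\<alpha> := a)) \<partial>?\<mu> \<partial>PiM (insert \<beta> R) (\<lambda>_. ?\<mu>))"
    unfolding TR(1) by (rule product_nn_integral_insert) (use TR f_meas' in auto)
  also have "\<dots> = (\<integral>\<^sup>+x. \<integral>\<^sup>+b. \<integral>\<^sup>+a. f (x(\<beta> := b, \<alpha> := a)) \<partial>?\<mu> \<partial>?\<mu> \<partial>PiM R (\<lambda>_. ?\<mu>))"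
  proof (rule product_nn_integral_insert)
    have "(\<lambda>z. f ((fst z)(\<alpha> := snd z))) \<in> borel_measurable (PiM (insert \<beta> R) (\<lambda>_. ?\<mu>) \<Otimes>\<^sub>M ?\<mu>)"
      using measurable_compose[OF measurable_add_dim f_meas'] by (simp add: case_prod_unfold)
    then show "(\<lambda>x. \<integral>\<^sup>+a. f (x(\<alpha> := a)) \<partial>?\<mu>) \<in> borel_measurable (PiM (insert \<beta> R) (\<lambda>_. ?\<mu>))"
      by (intro \<mu>.borel_measurable_nn_integral) (simp add: case_prod_unfold)
  qed (use TR in auto)
  also have "\<dots> \<le> (\<integral>\<^sup>+x. ennreal (2 * d / pi) \<partial>PiM R (\<lambda>_. ?\<mu>))"
  proof (rule nn_integral_mono)
    fix x
    define r where "r = (\<Sum>\<gamma>\<in>R. x \<gamma> * m \<gamma>)"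
    have "(\<Sum>\<gamma>\<in>T. (x(\<beta> := b, \<alpha> := a)) \<gamma> * m \<gamma>) = m \<alpha> * a + m \<beta> * b + r" for a b
    proof -
      have "(\<Sum>\<gamma>\<in>R. (x(\<beta> := b, \<alpha> := a)) \<gamma> * m \<gamma>) = r"
        unfolding r_def using TR by (intro sum.cong) auto
      then show ?thesis
        unfolding TR(1) using TR T(4) by (simp add: mult.commute)
    qed
    then have "f (x(\<beta> := b, \<alpha> := a)) = indicator {..<d} \<bar>m \<alpha> * a + m \<beta> * b + r\<bar> * ennreal \<bar>m \<beta> * a - m \<alpha> * b\<bar>" for a b
      using T(4) by (simp add: f_def)
    then show "(\<integral>\<^sup>+b. \<integral>\<^sup>+a. f (x(\<beta> := b, \<alpha> := a)) \<partial>?\<mu> \<partial>?\<mu>) \<le> ennreal (2 * d / pi)"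
      using gaussian_pair_slab_bound[OF m d, of r] by simp
  qed
  also have "\<dots> = ennreal (2 * d / pi)"
    by (simp add: prob_space.emeasure_space_1[OF prob_space_PiM[OF prob_space_normal_density]])
  finally show ?thesis .
qed

section \<open>Lebesgue measure on coordinate vectors\<close>

lemma lborel_eq_distr_vec_lambda:
  "(lborel :: (real ^ 'n::finite) measure) = distr (PiM UNIV (\<lambda>_. lborel)) borel (\<lambda>f. \<chi> k. f k)"
proof (rule lborel_eqI)
  interpret product_sigma_finite "\<lambda>_::'n. lborel :: real measure" ..
  have [measurable]: "(\<lambda>f. \<chi> k. (f k :: real)) \<in> PiM UNIV (\<lambda>_. lborel) \<rightarrow>\<^sub>M borel"
    unfolding borel_measurable_euclidean_space[of "\<lambda>f. \<chi> k. f k"]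
    by (auto simp: Basis_vec_def inner_axis)
  fix l u :: "real ^ 'n" assume lu: "\<And>b. b \<in> Basis \<Longrightarrow> l \<bullet> b \<le> u \<bullet> b"
  have lu': "l $ k \<le> u $ k" for k
    using lu[of "axis k 1"] by (simp add: inner_axis)
  have "emeasure (distr (PiM UNIV (\<lambda>_. lborel)) borel (\<lambda>f. \<chi> k. f k)) (box l u) =
    emeasure (PiM UNIV (\<lambda>_. lborel)) (Pi\<^sub>E UNIV (\<lambda>k. {l $ k<..<u $ k}))"
    by (subst emeasure_distr) (auto simp: mem_box_cart space_PiM PiE_def Pi_iff intro!: arg_cong2[where f=emeasure])
  also have "\<dots> = (\<Prod>k\<in>UNIV. emeasure lborel {l $ k<..<u $ k})"
    by (rule emeasure_PiM) auto
  also have "\<dots> = (\<Prod>k\<in>UNIV. ennreal (u $ k - l $ k))"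
    using lu' by (intro prod.cong) auto
  also have "\<dots> = ennreal (\<Prod>k\<in>UNIV. (u - l) $ k)"
    using lu' by (subst prod_ennreal) auto
  also have "(\<Prod>k\<in>UNIV. (u - l) $ k) = (\<Prod>b\<in>Basis. (u - l) \<bullet> b)"
    by (rule prod.reindex_bij_witness[of _ "\<lambda>b. THE k. b = axis k 1" "\<lambda>k. axis k 1"])
       (auto simp: Basis_vec_def inner_axis axis_eq_axis)
  finally show "emeasure (distr (PiM UNIV (\<lambda>_. lborel)) borel (\<lambda>f. \<chi> k. f k)) (box l u) =
     ennreal (\<Prod>b\<in>Basis. (u - l) \<bullet> b)" .
qed simp

lemma measurable_vec_lambda_PiM [measurable]:
  "(\<lambda>f. \<chi> k. (f k :: real)) \<in> PiM (UNIV :: 'n::finite set) (\<lambda>_. borel) \<rightarrow>\<^sub>M borel"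
  unfolding borel_measurable_euclidean_space[of "\<lambda>f. \<chi> k. f k"]
  by (auto simp: Basis_vec_def inner_axis)

lemma nn_integral_lborel_prod_vec:
  fixes g :: "'n::finite \<Rightarrow> real \<Rightarrow> ennreal"
  assumes [measurable]: "\<And>k. g k \<in> borel_measurable borel"
  shows "(\<integral>\<^sup>+x. (\<Prod>k\<in>UNIV. g k (x $ k)) \<partial>lborel) = (\<Prod>k\<in>UNIV. \<integral>\<^sup>+y. g k y \<partial>lborel)"
proof -
  interpret product_sigma_finite "\<lambda>_::'n. lborel :: real measure" ..
  have [measurable]: "(\<lambda>f. \<chi> k. (f k :: real)) \<in> PiM (UNIV :: 'n set) (\<lambda>_. lborel) \<rightarrow>\<^sub>M borel"
    using measurable_vec_lambda_PiM by (simp cong: measurable_cong_sets sets_PiM_cong)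
  have "(\<integral>\<^sup>+x. (\<Prod>k\<in>UNIV. g k (x $ k)) \<partial>lborel) =
    (\<integral>\<^sup>+f. (\<Prod>k\<in>UNIV. g k (f k)) \<partial>PiM UNIV (\<lambda>_. lborel))"
    by (subst lborel_eq_distr_vec_lambda, subst nn_integral_distr) auto
  also have "\<dots> = (\<Prod>k\<in>UNIV. \<integral>\<^sup>+y. g k y \<partial>lborel)"
    by (rule product_nn_integral_prod) auto
  finally show ?thesis .
qed

text \<open>This provides the absolute continuity of a vector of independent coefficients with respect to
Lebesgue measure: negligible sets of such vectors have probability zero.\<close>

lemma (in prob_space) distributed_vec:
  fixes Y :: "'n::finite \<Rightarrow> 'a \<Rightarrow> real"
  assumes ind: "indep_vars (\<lambda>_. borel) Y UNIV"
    and Y: "\<And>k. distributed M lborel (Y k) (f k)"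
  shows "distributed M lborel (\<lambda>\<omega>. \<chi> k. Y k \<omega>) (\<lambda>x. \<Prod>k\<in>UNIV. f k (x $ k))"
proof -
  have f[measurable]: "f k \<in> borel_measurable borel" for k
    using distributed_borel_measurable[OF Y] by simp
  have Ym[measurable]: "Y k \<in> borel_measurable M" for k
    using distributed_measurable[OF Y] by simp
  have distrY: "distr M borel (Y k) = density lborel (f k)" for k
    using distributed_distr_eq_density[OF Y[of k]] by (metis distr_cong sets_lborel)
  interpret L: product_sigma_finite "\<lambda>_::'n. lborel :: real measure" ..
  interpret D: product_sigma_finite "\<lambda>k. density lborel (f k)"
    unfolding distrY[symmetric]
    by (intro product_sigma_finite.intro prob_space_imp_sigma_finite prob_space_distr) simp
  have [measurable]: "(\<lambda>f. \<chi> k. (f k :: real)) \<in> PiM (UNIV :: 'n set) (\<lambda>_. lborel) \<rightarrow>\<^sub>M borel"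
    using measurable_vec_lambda_PiM by (simp cong: measurable_cong_sets sets_PiM_cong)
  have dens: "density (PiM UNIV (\<lambda>_. lborel)) (\<lambda>y. \<Prod>k\<in>UNIV. f k (y k)) = PiM UNIV (\<lambda>k. density lborel (f k))"
  proof (rule D.PiM_eqI)
    fix A :: "'n \<Rightarrow> real set" assume A: "\<And>k. k \<in> UNIV \<Longrightarrow> A k \<in> sets (density lborel (f k))"
    have [measurable]: "A k \<in> sets borel" for k using A[of k] by simp
    have "emeasure (density (PiM UNIV (\<lambda>_. lborel)) (\<lambda>y. \<Prod>k\<in>UNIV. f k (y k))) (Pi\<^sub>E UNIV A) =
      (\<integral>\<^sup>+y. (\<Prod>k\<in>UNIV. f k (y k)) * indicator (Pi\<^sub>E UNIV A) y \<partial>PiM UNIV (\<lambda>_. lborel))"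
      by (subst emeasure_density) (auto intro!: sets_PiM_I_finite)
    also have "\<dots> = (\<integral>\<^sup>+y. (\<Prod>k\<in>UNIV. f k (y k) * indicator (A k) (y k)) \<partial>PiM UNIV (\<lambda>_. lborel))"
      by (intro nn_integral_cong) (auto simp: indicator_def prod.distrib[symmetric] PiE_def Pi_def)
    also have "\<dots> = (\<Prod>k\<in>UNIV. \<integral>\<^sup>+x. f k x * indicator (A k) x \<partial>lborel)"
      by (rule L.product_nn_integral_prod) auto
    also have "\<dots> = (\<Prod>k\<in>UNIV. emeasure (density lborel (f k)) (A k))"
      by (intro prod.cong) (auto simp: emeasure_density)
    finally show "emeasure (density (PiM UNIV (\<lambda>_. lborel)) (\<lambda>y. \<Prod>k\<in>UNIV. f k (y k))) (Pi\<^sub>E UNIV A) =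
      (\<Prod>k\<in>UNIV. emeasure (density lborel (f k)) (A k))" .
  qed (auto cong: sets_PiM_cong)
  have vec_meas: "(\<lambda>\<omega>. \<lambda>k\<in>UNIV. Y k \<omega>) \<in> M \<rightarrow>\<^sub>M PiM UNIV (\<lambda>_. borel)"
    by (rule measurable_restrict) simp
  have "distr M lborel (\<lambda>\<omega>. \<chi> k. Y k \<omega>) = distr M borel (\<lambda>\<omega>. \<chi> k. Y k \<omega>)"
    by (rule distr_cong) auto
  also have "\<dots> = distr (distr M (PiM UNIV (\<lambda>_. borel)) (\<lambda>\<omega>. \<lambda>k\<in>UNIV. Y k \<omega>)) borel (\<lambda>f. \<chi> k. f k)"
    by (subst distr_distr[OF measurable_vec_lambda_PiM vec_meas]) (simp add: comp_def restrict_def)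
  also have "distr M (PiM UNIV (\<lambda>_. borel)) (\<lambda>\<omega>. \<lambda>k\<in>UNIV. Y k \<omega>) = PiM UNIV (\<lambda>k. density lborel (f k))"
    using indep_vars_iff_distr_eq_PiM'[of UNIV Y "\<lambda>_. borel"] ind distrY by simp
  also have "distr \<dots> borel (\<lambda>f. \<chi> k. f k) = density lborel (\<lambda>x. \<Prod>k\<in>UNIV. f k (x $ k))"
    unfolding dens[symmetric]
    by (subst lborel_eq_distr_vec_lambda, subst density_distr) auto
  finally show ?thesis
    using measurable_compose[OF vec_meas measurable_vec_lambda_PiM]
    by (simp add: distributed_def restrict_def)
qed

text \<open>Lebesgue measure is determined by its values on boxes, and the preimage of a box under \<open>B\<close> is its
image under the inverse matrix.\<close>

lemma nn_integral_linear_substitution: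
  fixes B :: "real^'n::{finite,wellorder}^'n::_"
  assumes B: "det B \<noteq> 0" and [measurable]: "f \<in> borel_measurable borel"
  shows "(\<integral>\<^sup>+w. ennreal \<bar>det B\<bar> * f (B *v w) \<partial>lborel) = (\<integral>\<^sup>+y. f y \<partial>lborel)"
proof -
  obtain C where C: "B ** C = mat 1" "C ** B = mat 1"
    using B by (metis invertible_def invertible_det_nz)
  have matrix_vector_measurable [measurable]: "(*v) B \<in> borel_measurable borel"
    by (intro borel_measurable_continuous_onI linear_continuous_on matrix_vector_mul_bounded_linear)
  have "(lborel :: ((real, 'n) vec) measure) = density (distr lborel borel ((*v) B)) (\<lambda>_. ennreal \<bar>det B\<bar>)"
  proof (rule lborel_eqI)
    fix l u :: "(real, 'n) vec" assume lu: "\<And>b. b \<in> Basis \<Longrightarrow> l \<bullet> b \<le> u \<bullet> b"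
    have BC: "B *v (C *v x) = x" "C *v (B *v x) = x" for x
      using C by (simp_all add: matrix_vector_mul_assoc)
    have pre: "(*v) B -` box l u = (*v) C ` box l u"
      using BC by (auto simp: image_iff) metis
    have "emeasure lborel ((*v) B -` box l u) = emeasure lebesgue ((*v) C ` box l u)"
      using measurable_sets_borel[OF matrix_vector_measurable borel_open[OF open_box[of l u]]]
      unfolding pre[symmetric] by simp
    also have "\<dots> = ennreal (\<bar>det C\<bar> * measure lebesgue (box l u))"
      using measurable_linear_image[of "(*v) C" "box l u"] measure_linear_image[of "(*v) C" "box l u"]
      by (simp add: emeasure_eq_measure2)
    finally have *: "emeasure lborel ((*v) B -` box l u) = ennreal (\<bar>det C\<bar> * measure lebesgue (box l u))" .
    have "emeasure (density (distr lborel borel ((*v) B)) (\<lambda>_. ennreal \<bar>det B\<bar>)) (box l u) =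
       ennreal \<bar>det B\<bar> * emeasure lborel ((*v) B -` box l u)"
      by (simp add: emeasure_density nn_integral_cmult_indicator emeasure_distr)
    also have "\<dots> = ennreal (\<bar>det B * det C\<bar> * measure lebesgue (box l u))"
      unfolding * by (simp add: ennreal_mult'[symmetric] abs_mult mult.assoc)
    also have "det B * det C = 1"
      using C(1) by (metis det_I det_mul)
    finally show "emeasure (density (distr lborel borel ((*v) B)) (\<lambda>_. ennreal \<bar>det B\<bar>)) (box l u) =
      ennreal (\<Prod>b\<in>Basis. (u - l) \<bullet> b)"
      using lu by (simp add: measure_completion)
  qed simp
  then have "(\<integral>\<^sup>+y. f y \<partial>lborel) = (\<integral>\<^sup>+y. f y \<partial>density (distr lborel borel ((*v) B)) (\<lambda>_. ennreal \<bar>det B\<bar>))"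
    by simp
  also have "\<dots> = (\<integral>\<^sup>+w. ennreal \<bar>det B\<bar> * f (B *v w) \<partial>lborel)"
    by (subst nn_integral_density) (auto simp: nn_integral_distr)
  finally show ?thesis ..
qed

text \<open>The function \<open>arctan (exp y)\<close> is an antiderivative on the half line \<open>y \<ge> 0\<close>; the other half follows
by symmetry.\<close>

lemma nn_integral_half_sech:
  "(\<integral>\<^sup>+y. ennreal (1 / (exp y + exp (- y))) \<partial>lborel) = ennreal (pi / 2)"
proof -
  let ?q = "\<lambda>y::real. 1 / (exp y + exp (- y))"
  have half: "(\<integral>\<^sup>+y. ennreal (?q y) * indicator {0..} y \<partial>lborel) = ennreal (pi / 4)"
  proof -
    have "(\<integral>\<^sup>+y. ennreal (?q y) * indicator {0..} y \<partial>lborel) = ennreal (pi / 2 - arctan (exp 0))"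
    proof (rule nn_integral_FTC_atLeast)
      show "((\<lambda>y. arctan (exp y)) \<longlongrightarrow> pi / 2) at_top"
        by (rule filterlim_compose[OF tendsto_arctan_at_top exp_at_top])
      fix y :: real
      have "exp y / (1 + (exp y)\<^sup>2) = ?q y"
        by (simp add: field_simps power2_eq_square exp_minus)
      then show "((\<lambda>y. arctan (exp y)) has_real_derivative ?q y) (at y)"
        by (auto intro!: derivative_eq_intros simp: field_simps)
    qed (auto simp: add_nonneg_nonneg)
    then show ?thesis by (simp add: arctan_one)
  qed
  have "(\<integral>\<^sup>+y. ennreal (?q y) \<partial>lborel) =
    (\<integral>\<^sup>+y. ennreal (?q y) * indicator {0..} y + ennreal (?q y) * indicator {..<0} y \<partial>lborel)"
    by (intro nn_integral_cong) (auto simp: indicator_def)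
  also have "\<dots> = ennreal (pi / 4) + (\<integral>\<^sup>+y. ennreal (?q y) * indicator {..<0} y \<partial>lborel)"
    by (subst nn_integral_add) (auto simp: half)
  also have "(\<integral>\<^sup>+y. ennreal (?q y) * indicator {..<0} y \<partial>lborel) =
    (\<integral>\<^sup>+y. ennreal (?q y) * indicator {..<0} (- y) \<partial>lborel)"
    by (subst nn_integral_real_affine[where c="-1" and t=0]) (auto simp: add.commute)
  also have "\<dots> = (\<integral>\<^sup>+y. ennreal (?q y) * indicator {0..} y \<partial>lborel)"
    using AE_lborel_singleton[of "0::real"] by (intro nn_integral_cong_AE) (auto simp: indicator_def)
  also have "ennreal (pi / 4) + \<dots> = ennreal (pi / 2)"
    unfolding half by (simp add: ennreal_plus[symmetric] del: ennreal_plus)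
  finally show ?thesis .
qed

text \<open>This is the integral belonging to a system of binomials: its Kac-Rice density becomes a product of
one-dimensional densities in the coordinates \<open>B *v w + t\<close>, each of total mass \<open>\<pi>/2\<close> up to
normalization.\<close>

lemma nn_integral_det_prod_half_sech:
  fixes B :: "real^'n::{finite,wellorder}^'n::_" and t :: "'n \<Rightarrow> real"
  assumes "det B \<noteq> 0"
  shows "(\<integral>\<^sup>+w. ennreal \<bar>det B\<bar> * (\<Prod>k\<in>UNIV. ennreal (1 / (exp ((B *v w) $ k + t k) + exp (- ((B *v w) $ k + t k))))) \<partial>lborel)
    = ennreal ((pi / 2) ^ CARD('n))"
proof -
  let ?q = "\<lambda>y::real. ennreal (1 / (exp y + exp (- y)))"
  have "(\<integral>\<^sup>+w. ennreal \<bar>det B\<bar> * (\<Prod>k\<in>UNIV. ?q ((B *v w) $ k + t k)) \<partial>lborel) =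
    (\<integral>\<^sup>+y. (\<Prod>k\<in>UNIV. ?q (y $ k + t k)) \<partial>lborel)"
    by (rule nn_integral_linear_substitution[OF assms, of "\<lambda>y. \<Prod>k\<in>UNIV. ?q (y $ k + t k)"])
      measurable
  also have "\<dots> = (\<Prod>k\<in>UNIV. \<integral>\<^sup>+x. ?q (x + t k) \<partial>lborel)"
    by (rule nn_integral_lborel_prod_vec) measurable
  also have "\<dots> = (\<Prod>k\<in>(UNIV::'n set). ennreal (pi / 2))"
  proof (rule prod.cong[OF refl])
    fix k
    show "(\<integral>\<^sup>+x. ?q (x + t k) \<partial>lborel) = ennreal (pi / 2)"
      unfolding nn_integral_half_sech[symmetric]
      by (subst (2) nn_integral_real_affine[where c=1 and t="t k"]) (auto simp: add.commute)
  qed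
  finally show ?thesis by (simp add: ennreal_power)
qed

section \<open>Normalized exponential sums\<close>

text \<open>The term of a fewnomial with exponent \<open>e \<alpha>\<close> in logarithmic coordinates, scaled by the standard
deviation \<open>s \<alpha>\<close> of its coefficient, so that the remaining random coefficient is standard normal.
Index \<open>\<alpha>\<close> and exponent \<open>e \<alpha>\<close> are kept apart because the index survives a reindexing of the
coordinates.\<close>

definition exp_weight :: "('e \<Rightarrow> real) \<Rightarrow> ('e \<Rightarrow> real ^ 'n::finite) \<Rightarrow> real ^ 'n \<Rightarrow> 'e \<Rightarrow> real" where
  "exp_weight s e w \<alpha> = s \<alpha> * exp (e \<alpha> \<bullet> w)"

definition exp_sum :: "'e set \<Rightarrow> ('e \<Rightarrow> real) \<Rightarrow> ('e \<Rightarrow> real ^ 'n::finite) \<Rightarrow> ('e \<Rightarrow> real) \<Rightarrow> real ^ 'n \<Rightarrow> real" where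
  "exp_sum T s e c w = (\<Sum>\<alpha>\<in>T. c \<alpha> * exp_weight s e w \<alpha>)"

definition normalized_sum :: "'e set \<Rightarrow> ('e \<Rightarrow> real) \<Rightarrow> ('e \<Rightarrow> real ^ 'n::finite) \<Rightarrow> ('e \<Rightarrow> real) \<Rightarrow> real ^ 'n \<Rightarrow> real" where
  "normalized_sum T s e c w = exp_sum T s e c w / L2_set (exp_weight s e w) T"

text \<open>The coefficient of \<open>e \<alpha> - e \<beta>\<close> in the gradient of the normalized sum. The linear form
\<open>m \<beta> c \<alpha> - m \<alpha> c \<beta>\<close> is orthogonal to \<open>\<Sum>\<gamma>. m \<gamma> c \<gamma>\<close>, so for standard normal \<open>c\<close> it is independent of the
value of the sum. Each unordered pair occurs twice, whence the factor \<open>2\<close> in the denominator.\<close>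

definition pair_coeff :: "'e set \<Rightarrow> ('e \<Rightarrow> real) \<Rightarrow> ('e \<Rightarrow> real) \<Rightarrow> 'e \<times> 'e \<Rightarrow> real" where
  "pair_coeff T m c = (\<lambda>(\<alpha>, \<beta>). m \<alpha> * m \<beta> * (m \<beta> * c \<alpha> - m \<alpha> * c \<beta>) / (2 * L2_set m T ^ 3))"

definition normalized_grad :: "'e set \<Rightarrow> ('e \<Rightarrow> real) \<Rightarrow> ('e \<Rightarrow> real ^ 'n::finite) \<Rightarrow> ('e \<Rightarrow> real) \<Rightarrow> real ^ 'n \<Rightarrow> real ^ 'n" where
  "normalized_grad T s e c w =
    (\<Sum>p\<in>T \<times> T. pair_coeff T (exp_weight s e w) c p *\<^sub>R (e (fst p) - e (snd p)))"

lemma exp_weight_pos: "0 < s \<alpha> \<Longrightarrow> 0 < exp_weight s e w \<alpha>"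
  by (simp add: exp_weight_def)

lemma L2_set_pos:
  assumes "finite T" "T \<noteq> {}" "\<And>\<alpha>. \<alpha> \<in> T \<Longrightarrow> 0 < m \<alpha>"
  shows "0 < L2_set m T"
  unfolding L2_set_def by (rule real_sqrt_gt_zero, rule sum_pos) (use assms in \<open>auto simp: less_imp_neq[symmetric] power2_eq_square\<close>)

lemma power2_L2_set: "(L2_set m T)\<^sup>2 = (\<Sum>\<alpha>\<in>T. (m \<alpha>)\<^sup>2)"
  by (simp add: L2_set_def sum_nonneg)

text \<open>This asymmetric form is what differentiation of the quotient produces; exchanging \<open>\<alpha>\<close> and \<open>\<beta>\<close>
and averaging turns it into the combination with the coefficients \<open>pair_coeff\<close>.\<close>

lemma normalized_grad_unsymmetrized:
  assumes "finite T"
  shows "normalized_grad T s e c w = (\<Sum>\<alpha>\<in>T. \<Sum>\<beta>\<in>T.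
     (c \<alpha> * exp_weight s e w \<alpha> * (exp_weight s e w \<beta>)\<^sup>2 / L2_set (exp_weight s e w) T ^ 3) *\<^sub>R (e \<alpha> - e \<beta>))"
proof -
  define m where "m = exp_weight s e w"
  define L where "L = L2_set m T"
  define A where "A \<alpha> \<beta> = (c \<alpha> * m \<alpha> * (m \<beta>)\<^sup>2 / L ^ 3) *\<^sub>R (e \<alpha> - e \<beta>)" for \<alpha> \<beta>
  have "pair_coeff T m c (\<alpha>, \<beta>) *\<^sub>R (e \<alpha> - e \<beta>) = (1/2) *\<^sub>R (A \<alpha> \<beta> + A \<beta> \<alpha>)" for \<alpha> \<beta>
  proof -
    have "A \<beta> \<alpha> = (- (c \<beta> * m \<beta> * (m \<alpha>)\<^sup>2 / L ^ 3)) *\<^sub>R (e \<alpha> - e \<beta>)"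
      unfolding A_def by (metis minus_diff_eq scaleR_minus_left scaleR_minus_right)
    moreover have "pair_coeff T m c (\<alpha>, \<beta>) = (1/2) * (c \<alpha> * m \<alpha> * (m \<beta>)\<^sup>2 / L ^ 3 + - (c \<beta> * m \<beta> * (m \<alpha>)\<^sup>2 / L ^ 3))"
      by (simp add: pair_coeff_def L_def[symmetric] power2_eq_square diff_divide_distrib right_diff_distrib mult_ac)
    ultimately show ?thesis
      unfolding A_def by (simp only: scaleR_add_left[symmetric] scaleR_scaleR)
  qed
  then have "normalized_grad T s e c w = (\<Sum>\<alpha>\<in>T. \<Sum>\<beta>\<in>T. (1/2) *\<^sub>R (A \<alpha> \<beta> + A \<beta> \<alpha>))"
    unfolding normalized_grad_def m_def[symmetric] sum.cartesian_product
    by (intro sum.cong) auto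
  also have "\<dots> = (1/2) *\<^sub>R ((\<Sum>\<alpha>\<in>T. \<Sum>\<beta>\<in>T. A \<alpha> \<beta>) + (\<Sum>\<alpha>\<in>T. \<Sum>\<beta>\<in>T. A \<beta> \<alpha>))"
    by (simp add: scaleR_sum_right sum.distrib scaleR_add_right)
  also have "(\<Sum>\<alpha>\<in>T. \<Sum>\<beta>\<in>T. A \<beta> \<alpha>) = (\<Sum>\<alpha>\<in>T. \<Sum>\<beta>\<in>T. A \<alpha> \<beta>)"
    by (rule sum.swap)
  finally show ?thesis
    by (simp add: A_def L_def m_def flip: scaleR_2)
qed

lemma has_derivative_exp_weight:
  "((\<lambda>w. exp_weight s e w \<alpha>) has_derivative (\<lambda>h. exp_weight s e w \<alpha> * (e \<alpha> \<bullet> h))) (at w)"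
  unfolding exp_weight_def by (auto intro!: derivative_eq_intros)

lemma has_derivative_exp_sum:
  "(exp_sum T s e c has_derivative (\<lambda>h. (\<Sum>\<alpha>\<in>T. (c \<alpha> * exp_weight s e w \<alpha>) *\<^sub>R e \<alpha>) \<bullet> h)) (at w)"
  unfolding exp_sum_def[abs_def]
  by (auto intro!: derivative_eq_intros has_derivative_exp_weight simp: inner_sum_left mult_ac)

text \<open>The derivative of \<open>1 / L\<close> contributes a multiple of the sum itself, and precisely this term completes
the weights to differences of exponents. Hence the gradient formula is exact away from zeros too,
and no error term has to be controlled on the set where the sum is merely small.\<close>

lemma has_derivative_normalized_sum:
  assumes T: "finite T" "T \<noteq> {}" "\<And>\<alpha>. \<alpha> \<in> T \<Longrightarrow> 0 < s \<alpha>"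
  shows "(normalized_sum T s e c has_derivative (\<lambda>h. normalized_grad T s e c w \<bullet> h)) (at w)"
proof -
  define m where "m = exp_weight s e w"
  define L where "L = L2_set m T"
  have L: "0 < L" "L\<^sup>2 = (\<Sum>\<alpha>\<in>T. (m \<alpha>)\<^sup>2)"
    using T by (auto simp: L_def power2_L2_set m_def intro!: L2_set_pos exp_weight_pos)
  have dL: "((\<lambda>w. L2_set (exp_weight s e w) T) has_derivative
     (\<lambda>h. (\<Sum>\<beta>\<in>T. (m \<beta>)\<^sup>2 * (e \<beta> \<bullet> h)) / L)) (at w)"
  proof -
    have "((\<lambda>w. \<Sum>\<beta>\<in>T. (exp_weight s e w \<beta>)\<^sup>2) has_derivative (\<lambda>h. \<Sum>\<beta>\<in>T. 2 * ((m \<beta>)\<^sup>2 * (e \<beta> \<bullet> h)))) (at w)"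
      by (auto intro!: derivative_eq_intros has_derivative_exp_weight sum.cong simp: m_def power2_eq_square)
    moreover have "sqrt (\<Sum>\<beta>\<in>T. (exp_weight s e w \<beta>)\<^sup>2) = L" "0 < (\<Sum>\<beta>\<in>T. (exp_weight s e w \<beta>)\<^sup>2)"
      using L by (simp_all add: L_def L2_set_def m_def flip: L(2))
    ultimately show ?thesis
      unfolding L2_set_def
      using DERIV_compose_FDERIV[OF DERIV_real_sqrt]
      by (fastforce simp: sum_distrib_left sum_divide_distrib field_simps)
  qed
  have "(normalized_sum T s e c has_derivative (\<lambda>h. - exp_sum T s e c w * (inverse L *
      ((\<Sum>\<beta>\<in>T. (m \<beta>)\<^sup>2 * (e \<beta> \<bullet> h)) / L) * inverse L) + ((\<Sum>\<alpha>\<in>T. (c \<alpha> * m \<alpha>) *\<^sub>R e \<alpha>) \<bullet> h) / L)) (at w)"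
    unfolding normalized_sum_def[abs_def]
    using has_derivative_divide[OF has_derivative_exp_sum[of T s e c w] dL] L(1)
    by (simp add: m_def[symmetric] L_def[symmetric])
  moreover have "- exp_sum T s e c w * (inverse L *
      ((\<Sum>\<beta>\<in>T. (m \<beta>)\<^sup>2 * (e \<beta> \<bullet> h)) / L) * inverse L) + ((\<Sum>\<alpha>\<in>T. (c \<alpha> * m \<alpha>) *\<^sub>R e \<alpha>) \<bullet> h) / L
      = normalized_grad T s e c w \<bullet> h" for h
  proof -
    define E where "E = (\<Sum>\<beta>\<in>T. (m \<beta>)\<^sup>2 * (e \<beta> \<bullet> h))"
    have "normalized_grad T s e c w \<bullet> h =
      (\<Sum>\<alpha>\<in>T. \<Sum>\<beta>\<in>T. (c \<alpha> * m \<alpha> / L ^ 3) * ((m \<beta>)\<^sup>2 * (e \<alpha> \<bullet> h) - (m \<beta>)\<^sup>2 * (e \<beta> \<bullet> h)))"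
      unfolding normalized_grad_unsymmetrized[OF T(1)] m_def[symmetric] L_def[symmetric]
      by (simp add: inner_sum_left inner_diff_left algebra_simps)
    also have "\<dots> = (\<Sum>\<alpha>\<in>T. (c \<alpha> * m \<alpha> / L ^ 3) * (L\<^sup>2 * (e \<alpha> \<bullet> h) - E))"
      unfolding L(2) E_def by (simp only: sum_distrib_left[symmetric] sum_subtractf sum_distrib_right[symmetric])
    also have "\<dots> = (\<Sum>\<alpha>\<in>T. (c \<alpha> * m \<alpha> * (e \<alpha> \<bullet> h)) / L - (c \<alpha> * m \<alpha>) * (E / L ^ 3))"
      using L(1) by (intro sum.cong) (auto simp: field_simps power2_eq_square power3_eq_cube)
    also have "\<dots> = ((\<Sum>\<alpha>\<in>T. (c \<alpha> * m \<alpha>) *\<^sub>R e \<alpha>) \<bullet> h) / L - exp_sum T s e c w * (E / L ^ 3)"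
      by (simp add: sum_subtractf sum_divide_distrib sum_distrib_right inner_sum_left exp_sum_def m_def)
    finally show ?thesis
      unfolding E_def[symmetric] by (simp add: field_simps power3_eq_cube)
  qed
  ultimately show ?thesis by simp
qed

text \<open>At a zero the normalization only rescales the gradient, so that degeneracy of a zero can be tested on
the unnormalized sum.\<close>

lemma normalized_grad_at_zero:
  assumes T: "finite T" "T \<noteq> {}" "\<And>\<alpha>. \<alpha> \<in> T \<Longrightarrow> 0 < s \<alpha>" and zero: "exp_sum T s e c w = 0"
  shows "normalized_grad T s e c w = (1 / L2_set (exp_weight s e w) T) *\<^sub>R (\<Sum>\<alpha>\<in>T. (c \<alpha> * exp_weight s e w \<alpha>) *\<^sub>R e \<alpha>)"
proof -
  define m where "m = exp_weight s e w"
  define L where "L = L2_set m T"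
  have L: "0 < L" "(\<Sum>\<alpha>\<in>T. (m \<alpha>)\<^sup>2) = L\<^sup>2"
    using T by (auto simp: L_def power2_L2_set m_def intro!: L2_set_pos exp_weight_pos)
  have "normalized_grad T s e c w =
    (\<Sum>\<alpha>\<in>T. \<Sum>\<beta>\<in>T. (m \<beta>)\<^sup>2 *\<^sub>R ((c \<alpha> * m \<alpha> / L ^ 3) *\<^sub>R e \<alpha>) - (c \<alpha> * m \<alpha>) *\<^sub>R (((m \<beta>)\<^sup>2 / L ^ 3) *\<^sub>R e \<beta>))"
    unfolding normalized_grad_unsymmetrized[OF T(1)] m_def[symmetric] L_def[symmetric]
    by (simp add: scaleR_diff_right mult_ac)
  also have "\<dots> = (\<Sum>\<alpha>\<in>T. L\<^sup>2 *\<^sub>R ((c \<alpha> * m \<alpha> / L ^ 3) *\<^sub>R e \<alpha>)) -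
      (\<Sum>\<alpha>\<in>T. c \<alpha> * m \<alpha>) *\<^sub>R (\<Sum>\<beta>\<in>T. ((m \<beta>)\<^sup>2 / L ^ 3) *\<^sub>R e \<beta>)"
    unfolding sum_subtractf scaleR_sum_left[symmetric] L(2) scaleR_sum_right[symmetric] by simp
  also have "(\<Sum>\<alpha>\<in>T. c \<alpha> * m \<alpha>) = 0" using zero by (simp add: exp_sum_def m_def)
  finally show ?thesis
    using L(1) unfolding m_def[symmetric] L_def[symmetric]
    by (simp add: scaleR_sum_right power2_eq_square power3_eq_cube)
qed

section \<open>Multilinearity of determinants and products\<close>

text \<open>Expansion of a determinant that is multilinear in its rows; the index set may vary with the row.\<close>

lemma det_sum_rows_PiE:
  fixes a :: "'n::finite \<Rightarrow> 'b \<Rightarrow> 'a::comm_ring_1 ^ 'n"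
  assumes "\<And>i. finite (S i)"
  shows "det (\<chi> i. \<Sum>p\<in>S i. a i p) = (\<Sum>f\<in>PiE UNIV S. det (\<chi> i. a i (f i)))"
proof -
  have "det (\<chi> i. \<Sum>p\<in>S i. a i p) = (\<Sum>\<pi> | \<pi> permutes UNIV. of_int (sign \<pi>) * (\<Prod>i\<in>UNIV. \<Sum>p\<in>S i. a i p $ \<pi> i))"
    by (simp add: det_def sum_component)
  also have "\<dots> = (\<Sum>\<pi> | \<pi> permutes UNIV. \<Sum>f\<in>PiE UNIV S. of_int (sign \<pi>) * (\<Prod>i\<in>UNIV. a i (f i) $ \<pi> i))"
    using assms by (simp add: prod_sum_PiE sum_distrib_left)
  also have "\<dots> = (\<Sum>f\<in>PiE UNIV S. det (\<chi> i. a i (f i)))"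
    unfolding det_def by (subst sum.swap) simp
  finally show ?thesis .
qed

lemma prod_mono_ennreal:
  fixes f g :: "'b \<Rightarrow> ennreal"
  assumes "\<And>k. k \<in> I \<Longrightarrow> f k \<le> g k"
  shows "prod f I \<le> prod g I"
  using assms by (induction I rule: infinite_finite_induct) (auto intro: mult_mono)

section \<open>Degenerate zeros\<close>

text \<open>Division by the monomial with index \<open>t\<close> turns its coefficient into a constant term. The second equation
compares the gradients; its first summand vanishes at zeros.\<close>

lemma exp_sum_divide_monomial:
  assumes "finite T" "t \<in> T" "0 < s t"
  shows "exp_sum T s e c w = exp_weight s e w t *
    (c t + exp_sum (T - {t}) (\<lambda>\<alpha>. s \<alpha> / s t) (\<lambda>\<alpha>. e \<alpha> - e t) c w)"
    and "(\<Sum>\<alpha>\<in>T. (c \<alpha> * exp_weight s e w \<alpha>) *\<^sub>R e \<alpha>) = exp_sum T s e c w *\<^sub>R e t + exp_weight s e w t *\<^sub>R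
     (\<Sum>\<alpha>\<in>T - {t}. (c \<alpha> * exp_weight (\<lambda>\<alpha>. s \<alpha> / s t) (\<lambda>\<alpha>. e \<alpha> - e t) w \<alpha>) *\<^sub>R (e \<alpha> - e t))"
proof -
  define m where "m = exp_weight s e w"
  define m' where "m' = exp_weight (\<lambda>\<alpha>. s \<alpha> / s t) (\<lambda>\<alpha>. e \<alpha> - e t) w"
  have m': "m t * m' \<alpha> = m \<alpha>" for \<alpha>
    using assms(3) by (simp add: m_def m'_def exp_weight_def inner_diff_left exp_diff)
  have sum: "exp_sum T s e c w = c t * m t + (\<Sum>\<alpha>\<in>T - {t}. c \<alpha> * m \<alpha>)"
    using assms(1,2) by (simp add: exp_sum_def m_def sum.remove)
  then show "exp_sum T s e c w = exp_weight s e w t *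
    (c t + exp_sum (T - {t}) (\<lambda>\<alpha>. s \<alpha> / s t) (\<lambda>\<alpha>. e \<alpha> - e t) c w)"
    unfolding sum unfolding exp_sum_def m_def[symmetric] m'_def[symmetric]
    by (simp add: distrib_left sum_distrib_left mult.left_commute[of "m t" "c \<alpha>" "m' \<alpha>" for \<alpha>] m' mult.commute[of "c t"])
  have "m t *\<^sub>R (\<Sum>\<alpha>\<in>T - {t}. (c \<alpha> * m' \<alpha>) *\<^sub>R (e \<alpha> - e t)) = (\<Sum>\<alpha>\<in>T - {t}. (c \<alpha> * m \<alpha>) *\<^sub>R (e \<alpha> - e t))"
    by (simp add: scaleR_sum_right mult.left_commute[of "m t" "c \<alpha>" "m' \<alpha>" for \<alpha>] m')
  also have "\<dots> = (\<Sum>\<alpha>\<in>T - {t}. (c \<alpha> * m \<alpha>) *\<^sub>R e \<alpha>) - (\<Sum>\<alpha>\<in>T - {t}. c \<alpha> * m \<alpha>) *\<^sub>R e t"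
    by (simp add: scaleR_diff_right sum_subtractf scaleR_sum_left)
  finally show "(\<Sum>\<alpha>\<in>T. (c \<alpha> * exp_weight s e w \<alpha>) *\<^sub>R e \<alpha>) = exp_sum T s e c w *\<^sub>R e t + exp_weight s e w t *\<^sub>R
     (\<Sum>\<alpha>\<in>T - {t}. (c \<alpha> * exp_weight (\<lambda>\<alpha>. s \<alpha> / s t) (\<lambda>\<alpha>. e \<alpha> - e t) w \<alpha>) *\<^sub>R (e \<alpha> - e t))"
    unfolding m_def[symmetric] m'_def[symmetric] sum
    using assms(1,2) by (simp add: sum.remove[of T t] scaleR_add_left)
qed

lemma has_derivative_vec_lambda_rows:
  fixes v :: "'m::finite \<Rightarrow> real ^ 'n::finite"
  assumes "\<And>k. (g k has_derivative (\<lambda>h. v k \<bullet> h)) (at w)"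
  shows "((\<lambda>w. \<chi> k. g k w) has_derivative (*v) (\<chi> k. v k)) (at w)"
proof -
  have "((*v) (\<chi> k. v k)) = (\<lambda>h. \<chi> k. v k \<bullet> h)"
    by (simp add: fun_eq_iff vec_eq_iff matrix_vector_mult_def inner_vec_def)
  then show ?thesis
    using assms by (auto simp: has_derivative_componentwise_within[of "\<lambda>w. \<chi> k. g k w"] Basis_vec_def inner_axis)
qed

text \<open>A vector \<open>y\<close> of constant terms admits a degenerate zero \<open>w\<close> only if it is the critical value at \<open>w\<close> of the
map formed by the negated remaining sums. Sard's theorem applies to that map.\<close>

lemma negligible_degenerate_constant_terms:
  fixes e :: "'n::{finite,wellorder} \<Rightarrow> 'e \<Rightarrow> (real, 'n) vec"
  shows "negligible {y. \<exists>w. (\<forall>k. y $ k + exp_sum (T k) (s k) (e k) (c k) w = 0) \<and>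
     det (\<chi> k. \<Sum>\<alpha>\<in>T k. (c k \<alpha> * exp_weight (s k) (e k) w \<alpha>) *\<^sub>R e k \<alpha>) = 0}" (is "negligible ?N")
proof -
  define g where "g w = (\<chi> k. exp_sum (T k) (s k) (e k) (\<lambda>\<alpha>. - c k \<alpha>) w)" for w
  define A where "A w = (\<chi> k. \<Sum>\<alpha>\<in>T k. (c k \<alpha> * exp_weight (s k) (e k) w \<alpha>) *\<^sub>R e k \<alpha>)" for w
  define A' where "A' w = (\<chi> k. \<Sum>\<alpha>\<in>T k. (- c k \<alpha> * exp_weight (s k) (e k) w \<alpha>) *\<^sub>R e k \<alpha>)" for w
  have A': "A' w = (\<chi> k. (-1) *s (A w $ k))" for w
    by (simp add: A_def A'_def vec_eq_iff sum_negf[symmetric])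
  have detA': "det (A' w) = 0" if "det (A w) = 0" for w
    unfolding A' det_rows_mul using that by simp
  have "negligible (g ` {w. det (A w) = 0})"
  proof (rule baby_Sard)
    fix w assume w: "w \<in> {w. det (A w) = 0}"
    have "(g has_derivative (*v) (A' w)) (at w)"
      unfolding g_def[abs_def] A'_def
      by (rule has_derivative_vec_lambda_rows, rule has_derivative_exp_sum)
    then show "(g has_derivative (*v) (A' w)) (at w within {w. det (A w) = 0})"
      by (rule has_derivative_at_withinI)
    show "rank (matrix ((*v) (A' w))) < CARD('n)"
      using w detA' unfolding less_rank_noninjective by (simp add: det_nz_iff_inj[symmetric])
  qed simp
  moreover have "?N \<subseteq> g ` {w. det (A w) = 0}"
  proof
    fix y assume "y \<in> ?N"
    then obtain w where w: "\<And>k. y $ k + exp_sum (T k) (s k) (e k) (c k) w = 0" "det (A w) = 0"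
      unfolding A_def by blast
    have "y = g w"
      using w(1) by (auto simp: g_def vec_eq_iff exp_sum_def sum_negf eq_neg_iff_add_eq_0)
    with w(2) show "y \<in> g ` {w. det (A w) = 0}" by blast
  qed
  ultimately show ?thesis by (rule negligible_subset)
qed

text \<open>The index type carries a well-order because the change of variables theorems for images of
Lebesgue measurable sets are stated for such index types.\<close>

locale gaussian_exp_system = prob_space M for M :: "'w measure" +
  fixes T :: "'n::{finite,wellorder} \<Rightarrow> 'e set"
    and s :: "'n \<Rightarrow> 'e \<Rightarrow> real"
    and e :: "'n \<Rightarrow> 'e \<Rightarrow> (real, 'n) vec"
    and \<xi> :: "'n \<Rightarrow> 'e \<Rightarrow> 'w \<Rightarrow> real"
  assumes finite_T [simp]: "\<And>k. finite (T k)"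
    and nonempty_T [simp]: "\<And>k. T k \<noteq> {}"
    and s_pos: "\<And>k \<alpha>. \<alpha> \<in> T k \<Longrightarrow> 0 < s k \<alpha>"
    and distributed_\<xi>: "\<And>k \<alpha>. \<alpha> \<in> T k \<Longrightarrow> distributed M lborel (\<xi> k \<alpha>) std_normal_density"
    and indep_\<xi>: "indep_vars (\<lambda>_. borel) (\<lambda>(k, \<alpha>). \<xi> k \<alpha>) (SIGMA k:UNIV. T k)"
begin

definition system :: "'w \<Rightarrow> (real, 'n) vec \<Rightarrow> (real, 'n) vec" where
  "system \<omega> w = (\<chi> k. normalized_sum (T k) (s k) (e k) (\<lambda>\<alpha>. \<xi> k \<alpha> \<omega>) w)"

definition jacobian :: "'w \<Rightarrow> (real, 'n) vec \<Rightarrow> ((real, 'n) vec, 'n) vec" where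
  "jacobian \<omega> w = (\<chi> k. normalized_grad (T k) (s k) (e k) (\<lambda>\<alpha>. \<xi> k \<alpha> \<omega>) w)"

lemma measurable_\<xi> [measurable]: "\<alpha> \<in> T k \<Longrightarrow> \<xi> k \<alpha> \<in> borel_measurable M"
  using distributed_measurable[OF distributed_\<xi>, of \<alpha> k] by simp

lemma L2_weight_pos: "0 < L2_set (exp_weight (s k) (e k) w) (T k)"
  by (intro L2_set_pos exp_weight_pos s_pos) auto

lemma system_eq_0_iff:
  "system \<omega> w = 0 \<longleftrightarrow> (\<forall>k. exp_sum (T k) (s k) (e k) (\<lambda>\<alpha>. \<xi> k \<alpha> \<omega>) w = 0)"
  using L2_weight_pos by (auto simp: system_def vec_eq_iff normalized_sum_def) (metis less_irrefl)

lemma has_derivative_system: "(system \<omega> has_derivative (*v) (jacobian \<omega> w)) (at w)"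
  unfolding system_def[abs_def] jacobian_def
  by (intro has_derivative_vec_lambda_rows has_derivative_normalized_sum s_pos) auto

lemma continuous_jacobian: "continuous_on UNIV (jacobian \<omega>)"
  unfolding jacobian_def normalized_grad_def pair_coeff_def exp_weight_def L2_set_def case_prod_unfold
  by (intro continuous_intros)
     (use L2_weight_pos in \<open>auto simp: exp_weight_def L2_set_def less_imp_neq[symmetric]\<close>)

text \<open>One coefficient of every equation is singled out. Given all the other coefficients, the singled out
ones form a vector with a density, which avoids the negligible set of vectors of constant terms with
a degenerate zero. Fubini's theorem combines these statements.\<close>

lemma AE_zeros_nondegenerate:
  "AE \<omega> in M. \<forall>w. system \<omega> w = 0 \<longrightarrow> det (jacobian \<omega> w) \<noteq> 0"
proof -
  define t where "t k = (SOME \<alpha>. \<alpha> \<in> T k)" for k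
  have t: "t k \<in> T k" for k
    by (simp add: t_def some_in_eq)
  define T1 where "T1 k = T k - {t k}" for k
  define s1 where "s1 k \<alpha> = s k \<alpha> / s k (t k)" for k \<alpha>
  define e1 where "e1 k \<alpha> = e k \<alpha> - e k (t k)" for k \<alpha>
  define P where "P = PiM (SIGMA k:UNIV. T1 k) (\<lambda>_. borel :: real measure)"
  define I0 where "I0 = range (\<lambda>k. (k, t k))"
  define P0 where "P0 = PiM I0 (\<lambda>_. borel :: real measure)"
  define V where "V v = (\<chi> k. v (k, t k))" for v :: "'n \<times> 'e \<Rightarrow> real"
  define Y0 where "Y0 \<omega> = (\<lambda>i\<in>I0. (case i of (k, \<alpha>) \<Rightarrow> \<xi> k \<alpha>) \<omega>)" for \<omega>
  define X0 where "X0 \<omega> = (\<chi> k. \<xi> k (t k) \<omega>)" for \<omega>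
  define X1 where "X1 \<omega> = (\<lambda>i\<in>(SIGMA k:UNIV. T1 k). (case i of (k, \<alpha>) \<Rightarrow> \<xi> k \<alpha>) \<omega>)" for \<omega>
  define A where "A x w = (\<chi> k. \<Sum>\<alpha>\<in>T1 k. (x (k, \<alpha>) * exp_weight (s1 k) (e1 k) w \<alpha>) *\<^sub>R e1 k \<alpha>)" for x w
  \<comment> \<open>The degeneracy conditions are packed into one continuous nonnegative function of \<open>w\<close>, whose
    zeros are the degenerate zeros of the system with coefficients \<open>x\<close> and constant terms \<open>y\<close>;
    this makes the exceptional event measurable.\<close>
  define H where "H = (\<lambda>(x, y::(real,'n) vec) w.
     (\<Sum>k\<in>UNIV. \<bar>y $ k + exp_sum (T1 k) (s1 k) (e1 k) (\<lambda>\<alpha>. x (k, \<alpha>)) w\<bar>) + \<bar>det (A x w)\<bar>)"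
  have H0: "H (x, y) w = 0 \<longleftrightarrow>
    (\<forall>k. y $ k + exp_sum (T1 k) (s1 k) (e1 k) (\<lambda>\<alpha>. x (k, \<alpha>)) w = 0) \<and> det (A x w) = 0" for x y w
    unfolding H_def by (simp add: add_nonneg_eq_0_iff sum_nonneg sum_nonneg_eq_0_iff)
  have pred: "Measurable.pred (P \<Otimes>\<^sub>M borel) (\<lambda>z. \<exists>w\<in>UNIV. H z w = 0)"
  proof (rule pred_exists_zero_in_open)
    show "continuous_on UNIV (H z)" for z
      unfolding H_def case_prod_unfold A_def det_def exp_sum_def exp_weight_def
      by (intro continuous_intros continuous_on_component)
    have comp: "(\<lambda>z. fst z (k, \<alpha>)) \<in> borel_measurable (P \<Otimes>\<^sub>M (borel :: (real,'n) vec measure))" if "\<alpha> \<in> T1 k" for k \<alpha>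
      unfolding P_def using that
      by (intro measurable_compose[OF measurable_fst] measurable_component_singleton) auto
    have comp': "(\<lambda>z. snd z $ k) \<in> borel_measurable (P \<Otimes>\<^sub>M (borel :: (real,'n) vec measure))" for k
      by (rule measurable_compose[OF measurable_snd]) measurable
    show "(\<lambda>z. H z w) \<in> borel_measurable (P \<Otimes>\<^sub>M borel)" for w
      unfolding H_def case_prod_unfold A_def det_def exp_sum_def
      by (simp add: sum_component)
        (intro borel_measurable_add borel_measurable_sum borel_measurable_abs borel_measurable_times
          borel_measurable_prod borel_measurable_const comp comp')
  qed simp
  have ind: "indep_var P X1 P0 Y0"
    unfolding P_def X1_def P0_def Y0_def
    by (rule indep_var_restrict[OF indep_\<xi>]) (use t in \<open>auto simp: I0_def T1_def\<close>)
  have V_Y0: "V (Y0 \<omega>) = X0 \<omega>" for \<omega>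
    by (simp add: V_def Y0_def X0_def I0_def)
  have V_meas: "V \<in> P0 \<rightarrow>\<^sub>M borel"
    unfolding borel_measurable_euclidean_space[of V]
    by (auto simp: Basis_vec_def inner_axis V_def P0_def I0_def intro!: measurable_component_singleton)
  have pred': "Measurable.pred (P \<Otimes>\<^sub>M P0) (\<lambda>z. \<exists>w\<in>UNIV. H (fst z, V (snd z)) w = 0)"
    by (rule measurable_compose[OF _ pred])
      (intro measurable_Pair measurable_fst measurable_compose[OF measurable_snd V_meas])
  note rv = indep_var_rv1[OF ind] indep_var_rv2[OF ind]
  have X0: "distributed M lborel X0 (\<lambda>x. \<Prod>k\<in>UNIV. ennreal (std_normal_density (x $ k)))"
    unfolding X0_def
  proof (rule distributed_vec)
    show "indep_vars (\<lambda>_. borel) (\<lambda>k. \<xi> k (t k)) UNIV"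
      using indep_vars_reindex[OF indep_\<xi>, of "\<lambda>k. (k, t k)" UNIV] t by (auto simp: inj_on_def)
  qed (use t distributed_\<xi> in auto)
  have X0_meas [measurable]: "X0 \<in> borel_measurable M"
    using distributed_measurable[OF X0] by simp
  have AE_X0: "AE \<omega> in M. \<not> (\<exists>w\<in>UNIV. H (x, X0 \<omega>) w = 0)" for x
  proof -
    have "{y. \<exists>w\<in>UNIV. H (x, y) w = 0} \<in> null_sets lebesgue"
      using negligible_degenerate_constant_terms[of T1 s1 e1 "\<lambda>k \<alpha>. x (k, \<alpha>)"]
      by (simp add: H0 A_def negligible_iff_null_sets)
    then have "AE y in lborel. \<not> (\<exists>w\<in>UNIV. H (x, y) w = 0)"
      by (auto dest!: AE_not_in simp: AE_completion_iff)
    then have "AE y in distr M lborel X0. \<not> (\<exists>w\<in>UNIV. H (x, y) w = 0)"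
      unfolding distributed_distr_eq_density[OF X0]
      by (subst AE_density) (auto elim: eventually_mono)
    then show ?thesis
      by (rule AE_distrD[rotated]) simp
  qed
  have "AE z in distr M P X1 \<Otimes>\<^sub>M distr M P0 Y0. \<not> (\<exists>w\<in>UNIV. H (fst z, V (snd z)) w = 0)"
  proof -
    interpret pair_sigma_finite "distr M P X1" "distr M P0 Y0"
      using rv by (intro pair_sigma_finite.intro prob_space_imp_sigma_finite prob_space_distr)
    have [measurable]: "Measurable.pred (distr M P X1 \<Otimes>\<^sub>M distr M P0 Y0) (\<lambda>z. \<exists>w\<in>UNIV. H (fst z, V (snd z)) w = 0)"
      using pred' by (simp cong: measurable_cong_sets sets_pair_measure_cong)
    have "Measurable.pred (distr M P X1 \<Otimes>\<^sub>M distr M P0 Y0) (\<lambda>z. \<not> (\<exists>w\<in>UNIV. H (fst z, V (snd z)) w = 0))"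
      by measurable
    moreover have "AE v in distr M P0 Y0. \<not> (\<exists>w\<in>UNIV. H (x, V v) w = 0)" if "x \<in> space P" for x
    proof -
      have [measurable]: "Measurable.pred P0 (\<lambda>v. \<exists>w\<in>UNIV. H (x, V v) w = 0)"
        using measurable_compose[OF measurable_Pair1'[OF that] pred'] by simp
      have "Measurable.pred P0 (\<lambda>v. \<not> (\<exists>w\<in>UNIV. H (x, V v) w = 0))"
        by measurable
      then show ?thesis
        using AE_X0[of x] rv(2) by (subst AE_distr_iff) (auto simp: pred_def V_Y0)
    qed
    ultimately show ?thesis
      by (intro AE_pair_measure[OF _ AE_I2]) (simp_all add: pred_def)
  qed
  then have "AE z in distr M (P \<Otimes>\<^sub>M P0) (\<lambda>\<omega>. (X1 \<omega>, Y0 \<omega>)). \<not> (\<exists>w\<in>UNIV. H (fst z, V (snd z)) w = 0)"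
    using ind unfolding indep_var_distribution_eq by (metis (no_types, lifting))
  then have "AE \<omega> in M. \<not> (\<exists>w\<in>UNIV. H (X1 \<omega>, X0 \<omega>) w = 0)"
    using AE_distrD[OF measurable_Pair[OF rv]] by (fastforce simp: V_Y0)
  then show ?thesis
  proof eventually_elim
    case (elim \<omega>)
    show ?case
    proof (intro allI impI notI)
      fix w assume zero: "system \<omega> w = 0" and det0: "det (jacobian \<omega> w) = 0"
      define c where "c k \<alpha> = \<xi> k \<alpha> \<omega>" for k \<alpha>
      have z: "exp_sum (T k) (s k) (e k) (c k) w = 0" for k
        using zero by (simp add: system_eq_0_iff c_def[abs_def])
      have st: "0 < s k (t k)" "0 < exp_weight (s k) (e k) w (t k)" for k
        using t s_pos by (auto intro!: exp_weight_pos)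
      have X1: "exp_sum (T1 k) (s1 k) (e1 k) (\<lambda>\<alpha>. X1 \<omega> (k, \<alpha>)) w = exp_sum (T1 k) (s1 k) (e1 k) (c k) w" for k
        unfolding exp_sum_def by (intro sum.cong) (auto simp: X1_def c_def)
      have AX1: "A (X1 \<omega>) w $ k = (\<Sum>\<alpha>\<in>T1 k. (c k \<alpha> * exp_weight (s1 k) (e1 k) w \<alpha>) *\<^sub>R e1 k \<alpha>)" for k
        unfolding A_def by (auto simp: X1_def c_def intro!: sum.cong)
      have "X0 \<omega> $ k + exp_sum (T1 k) (s1 k) (e1 k) (\<lambda>\<alpha>. X1 \<omega> (k, \<alpha>)) w = 0" for k
        using exp_sum_divide_monomial(1)[of "T k" "t k" "s k" "e k" "c k" w] finite_T[of k] t[of k] st(1)[of k] z[of k] st(2)[of k]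
        unfolding X1 unfolding T1_def s1_def[abs_def] e1_def[abs_def] by (simp add: X0_def c_def)
      moreover have "det (A (X1 \<omega>) w) = 0"
      proof -
        define r where "r k = exp_weight (s k) (e k) w (t k) / L2_set (exp_weight (s k) (e k) w) (T k)" for k
        have r: "r k > 0" for k using st(2) L2_weight_pos by (simp add: r_def)
        have "jacobian \<omega> w $ k = r k *s (A (X1 \<omega>) w $ k)" for k
        proof -
          have "jacobian \<omega> w $ k = (1 / L2_set (exp_weight (s k) (e k) w) (T k)) *\<^sub>R
            (\<Sum>\<alpha>\<in>T k. (c k \<alpha> * exp_weight (s k) (e k) w \<alpha>) *\<^sub>R e k \<alpha>)"
            using normalized_grad_at_zero[of "T k" "s k" "e k" "c k" w] s_pos[of _ k] z[of k]
            by (simp add: jacobian_def c_def[abs_def])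
          also have "(\<Sum>\<alpha>\<in>T k. (c k \<alpha> * exp_weight (s k) (e k) w \<alpha>) *\<^sub>R e k \<alpha>) =
            exp_weight (s k) (e k) w (t k) *\<^sub>R (A (X1 \<omega>) w $ k)"
            using exp_sum_divide_monomial(2)[of "T k" "t k" "s k" "c k" "e k" w] finite_T[of k] t[of k] st(1)[of k] z[of k]
            unfolding AX1 T1_def s1_def[abs_def] e1_def[abs_def] by simp
          finally show ?thesis
            by (simp add: r_def scalar_mult_eq_scaleR)
        qed
        then have "jacobian \<omega> w = (\<chi> k. r k *s (A (X1 \<omega>) w $ k))"
          by (simp add: vec_eq_iff)
        then have "det (jacobian \<omega> w) = (\<Prod>k\<in>UNIV. r k) * det (A (X1 \<omega>) w)"
          by (simp only: det_rows_mul) simp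
        moreover have "(\<Prod>k\<in>UNIV. r k) \<noteq> 0" using r by (simp add: less_imp_neq[symmetric])
        ultimately show ?thesis using det0 by simp
      qed
      ultimately show False using elim by (auto simp: H0)
    qed
  qed
qed

section \<open>The expected number of zeros\<close>

definition off_diagonal :: "'n \<Rightarrow> ('e \<times> 'e) set" where
  "off_diagonal k = {p \<in> T k \<times> T k. fst p \<noteq> snd p}"

definition difference_matrix :: "('n \<Rightarrow> 'e \<times> 'e) \<Rightarrow> ((real, 'n) vec, 'n) vec" where
  "difference_matrix f = (\<chi> k. e k (fst (f k)) - e k (snd (f k)))"

abbreviation coeff :: "'w \<Rightarrow> (real, 'n) vec \<Rightarrow> 'n \<Rightarrow> 'e \<times> 'e \<Rightarrow> real" where
  "coeff \<omega> w k \<equiv> pair_coeff (T k) (exp_weight (s k) (e k) w) (\<lambda>\<alpha>. \<xi> k \<alpha> \<omega>)"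

lemma finite_off_diagonal [simp]: "finite (off_diagonal k)"
  by (rule finite_subset[of _ "T k \<times> T k"]) (auto simp: off_diagonal_def)

lemma card_off_diagonal: "real (card (off_diagonal k)) = real (card (T k)) * (real (card (T k)) - 1)"
proof -
  have "off_diagonal k = T k \<times> T k - (\<lambda>\<alpha>. (\<alpha>, \<alpha>)) ` T k"
    by (auto simp: off_diagonal_def)
  then have "card (off_diagonal k) = card (T k) * card (T k) - card (T k)"
    by (simp add: card_Diff_subset image_subset_iff card_image inj_on_def card_cartesian_product)
  moreover have "card (T k) \<le> card (T k) * card (T k)"
    by simp
  ultimately show ?thesis
    by (simp add: of_nat_diff algebra_simps)
qed

text \<open>Every row of the Jacobian is a combination of exponent differences, so multilinearity and the
triangle inequality reduce the determinant to those of systems of binomials. Pairs on the diagonal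
contribute zero vectors and are left out, which is what yields \<open>t (t - 1)\<close> instead of \<open>t^2\<close>.\<close>

lemma abs_det_jacobian_le:
  "\<bar>det (jacobian \<omega> w)\<bar> \<le>
    (\<Sum>f\<in>PiE UNIV off_diagonal. (\<Prod>k\<in>UNIV. \<bar>coeff \<omega> w k (f k)\<bar>) * \<bar>det (difference_matrix f)\<bar>)"
proof -
  have row: "jacobian \<omega> w $ k = (\<Sum>p\<in>off_diagonal k. coeff \<omega> w k p *s (e k (fst p) - e k (snd p)))" for k
    unfolding jacobian_def normalized_grad_def vec_lambda_beta scalar_mult_eq_scaleR
    by (rule sum.mono_neutral_right) (auto simp: off_diagonal_def)
  have "det (jacobian \<omega> w) = det (\<chi> k. \<Sum>p\<in>off_diagonal k. coeff \<omega> w k p *s (e k (fst p) - e k (snd p)))"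
    by (rule arg_cong[of _ _ det]) (simp add: vec_eq_iff row)
  also have "\<dots> = (\<Sum>f\<in>PiE UNIV off_diagonal. (\<Prod>k\<in>UNIV. coeff \<omega> w k (f k)) * det (difference_matrix f))"
    by (subst det_sum_rows_PiE) (simp_all only: det_rows_mul difference_matrix_def finite_off_diagonal)
  finally have "\<bar>det (jacobian \<omega> w)\<bar> \<le>
    (\<Sum>f\<in>PiE UNIV off_diagonal. \<bar>(\<Prod>k\<in>UNIV. coeff \<omega> w k (f k)) * det (difference_matrix f)\<bar>)"
    by (simp add: sum_abs)
  then show ?thesis by (simp add: abs_mult abs_prod)
qed

lemma indep_row: "indep_vars (\<lambda>_. borel) (\<xi> k) (T k)"
  using indep_vars_reindex[OF indep_\<xi>, of "\<lambda>\<alpha>. (k, \<alpha>)" "T k"] by (auto simp: inj_on_def)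

text \<open>After scaling by \<open>L\<close> this is the slab bound for a Gaussian pair. The squared norm \<open>L\<^sup>2\<close> is at least
\<open>m \<alpha>^2 + m \<beta>^2\<close>; dropping the other weights leaves the density that belongs to the binomial with
the terms \<open>\<alpha>\<close> and \<open>\<beta>\<close>, a function of the ratio \<open>m \<alpha> / m \<beta>\<close> alone.\<close>

lemma expected_pair_term_le:
  assumes p: "p \<in> off_diagonal k" and \<epsilon>: "0 < \<epsilon>"
  shows "(\<integral>\<^sup>+\<omega>. indicator {..<\<epsilon>} \<bar>system \<omega> w $ k\<bar> * ennreal \<bar>coeff \<omega> w k p\<bar> \<partial>M) \<le>
    ennreal (\<epsilon> / pi) * ennreal (1 / (exp ((e k (fst p) - e k (snd p)) \<bullet> w + ln (s k (fst p) / s k (snd p))) +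
       exp (- ((e k (fst p) - e k (snd p)) \<bullet> w + ln (s k (fst p) / s k (snd p))))))"
proof -
  obtain \<alpha> \<beta> where ab: "p = (\<alpha>, \<beta>)" "\<alpha> \<in> T k" "\<beta> \<in> T k" "\<alpha> \<noteq> \<beta>"
    using p by (cases p) (auto simp: off_diagonal_def)
  define m where "m = exp_weight (s k) (e k) w"
  define L where "L = L2_set m (T k)"
  have m: "0 < m \<gamma>" if "\<gamma> \<in> T k" for \<gamma> using that by (simp add: m_def exp_weight_pos s_pos)
  have L: "0 < L" using L2_weight_pos by (simp add: L_def m_def)
  define K where "K = m \<alpha> * m \<beta> / (2 * L ^ 3)"
  have K: "0 < K" using m ab L by (simp add: K_def)
  define y where "y = (e k \<alpha> - e k \<beta>) \<bullet> w + ln (s k \<alpha> / s k \<beta>)"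
  have "indicator {..<\<epsilon>} \<bar>system \<omega> w $ k\<bar> * ennreal \<bar>coeff \<omega> w k p\<bar> = ennreal K *
     (indicator {..<\<epsilon> * L} \<bar>\<Sum>\<gamma>\<in>T k. \<xi> k \<gamma> \<omega> * m \<gamma>\<bar> * ennreal \<bar>m \<beta> * \<xi> k \<alpha> \<omega> - m \<alpha> * \<xi> k \<beta> \<omega>\<bar>)" for \<omega>
  proof -
    have "system \<omega> w $ k = (\<Sum>\<gamma>\<in>T k. \<xi> k \<gamma> \<omega> * m \<gamma>) / L"
      by (simp add: system_def normalized_sum_def exp_sum_def m_def L_def)
    then have "\<bar>system \<omega> w $ k\<bar> < \<epsilon> \<longleftrightarrow> \<bar>\<Sum>\<gamma>\<in>T k. \<xi> k \<gamma> \<omega> * m \<gamma>\<bar> < \<epsilon> * L"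
      using L by (simp add: pos_divide_less_eq)
    moreover have "\<bar>coeff \<omega> w k p\<bar> = K * \<bar>m \<beta> * \<xi> k \<alpha> \<omega> - m \<alpha> * \<xi> k \<beta> \<omega>\<bar>"
      using L m[OF ab(2)] m[OF ab(3)]
      by (simp add: ab pair_coeff_def m_def[symmetric] L_def[symmetric] K_def abs_mult)
    ultimately show ?thesis
      using K by (simp add: indicator_def ennreal_mult')
  qed
  then have "(\<integral>\<^sup>+\<omega>. indicator {..<\<epsilon>} \<bar>system \<omega> w $ k\<bar> * ennreal \<bar>coeff \<omega> w k p\<bar> \<partial>M) =
    (\<integral>\<^sup>+\<omega>. ennreal K * (indicator {..<\<epsilon> * L} \<bar>\<Sum>\<gamma>\<in>T k. \<xi> k \<gamma> \<omega> * m \<gamma>\<bar> *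
      ennreal \<bar>m \<beta> * \<xi> k \<alpha> \<omega> - m \<alpha> * \<xi> k \<beta> \<omega>\<bar>) \<partial>M)" by simp
  also have "\<dots> = ennreal K * (\<integral>\<^sup>+\<omega>. indicator {..<\<epsilon> * L} \<bar>\<Sum>\<gamma>\<in>T k. \<xi> k \<gamma> \<omega> * m \<gamma>\<bar> *
      ennreal \<bar>m \<beta> * \<xi> k \<alpha> \<omega> - m \<alpha> * \<xi> k \<beta> \<omega>\<bar> \<partial>M)"
  proof (rule nn_integral_cmult)
    have [measurable]: "(\<lambda>\<omega>. \<Sum>\<gamma>\<in>T k. \<xi> k \<gamma> \<omega> * m \<gamma>) \<in> borel_measurable M"
      by (intro borel_measurable_sum) measurable
    show "(\<lambda>\<omega>. indicator {..<\<epsilon> * L} \<bar>\<Sum>\<gamma>\<in>T k. \<xi> k \<gamma> \<omega> * m \<gamma>\<bar> *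
      ennreal \<bar>m \<beta> * \<xi> k \<alpha> \<omega> - m \<alpha> * \<xi> k \<beta> \<omega>\<bar>) \<in> borel_measurable M"
      using ab by measurable
  qed
  also have "\<dots> \<le> ennreal K * ennreal (2 * (\<epsilon> * L) / pi)"
    by (intro mult_left_mono gaussian_slab_pair_bound indep_row distributed_\<xi> m) (use ab \<epsilon> L in auto)
  also have "\<dots> = ennreal (\<epsilon> / pi) * ennreal (m \<alpha> * m \<beta> / L\<^sup>2)"
    using K \<epsilon> L by (simp add: ennreal_mult'[symmetric] K_def power2_eq_square power3_eq_cube mult_ac)
  also have "\<dots> \<le> ennreal (\<epsilon> / pi) * ennreal (1 / (exp y + exp (- y)))"
  proof (intro mult_left_mono ennreal_leI)
    have "(m \<alpha>)\<^sup>2 + (m \<beta>)\<^sup>2 = (\<Sum>\<gamma>\<in>{\<alpha>, \<beta>}. (m \<gamma>)\<^sup>2)" using ab by simp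
    also have "\<dots> \<le> L\<^sup>2"
      unfolding L_def power2_L2_set using ab by (intro sum_mono2) auto
    finally have "m \<alpha> * m \<beta> / L\<^sup>2 \<le> m \<alpha> * m \<beta> / ((m \<alpha>)\<^sup>2 + (m \<beta>)\<^sup>2)"
      using m[OF ab(2)] m[OF ab(3)] L
      by (intro divide_left_mono mult_pos_pos add_pos_pos zero_less_power) auto
    also have "\<dots> = 1 / (m \<alpha> / m \<beta> + m \<beta> / m \<alpha>)"
      using m[OF ab(2)] m[OF ab(3)] by (simp add: field_simps power2_eq_square)
    also have "m \<alpha> / m \<beta> = exp y"
      using s_pos[OF ab(2)] s_pos[OF ab(3)]
      by (simp add: m_def exp_weight_def y_def exp_add exp_diff inner_diff_left mult.commute)
    also have "m \<beta> / m \<alpha> = exp (- y)"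
      using s_pos[OF ab(2)] s_pos[OF ab(3)]
      by (simp add: m_def exp_weight_def y_def exp_add exp_diff inner_diff_left exp_minus mult.commute)
    finally show "m \<alpha> * m \<beta> / L\<^sup>2 \<le> 1 / (exp y + exp (- y))" .
  qed simp
  finally show ?thesis by (simp add: ab y_def)
qed

lemma measurable_system_component:
  "(\<lambda>z. system (fst z) (snd z) $ k) \<in> borel_measurable (M \<Otimes>\<^sub>M borel)"
proof -
  have [measurable]: "(\<lambda>z. \<xi> k \<alpha> (fst z)) \<in> borel_measurable (M \<Otimes>\<^sub>M borel)" if "\<alpha> \<in> T k" for \<alpha>
    using that by (intro measurable_compose[OF measurable_fst measurable_\<xi>])
  have [measurable]: "(\<lambda>z. exp_weight (s k) (e k) (snd z) \<alpha>) \<in> borel_measurable (M \<Otimes>\<^sub>M borel)" for \<alpha>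
    unfolding exp_weight_def by measurable
  show ?thesis
    unfolding system_def normalized_sum_def exp_sum_def L2_set_def vec_lambda_beta
    by (intro borel_measurable_divide borel_measurable_sum borel_measurable_sqrt) measurable
qed

lemma measurable_coeff:
  assumes "p \<in> T k \<times> T k"
  shows "(\<lambda>z. coeff (fst z) (snd z) k p) \<in> borel_measurable (M \<Otimes>\<^sub>M borel)"
proof -
  obtain \<alpha> \<beta> where p: "p = (\<alpha>, \<beta>)" "\<alpha> \<in> T k" "\<beta> \<in> T k" using assms by auto
  have [measurable]: "(\<lambda>z. \<xi> k \<alpha> (fst z)) \<in> borel_measurable (M \<Otimes>\<^sub>M borel)"
    "(\<lambda>z. \<xi> k \<beta> (fst z)) \<in> borel_measurable (M \<Otimes>\<^sub>M borel)"
    using p by (intro measurable_compose[OF measurable_fst measurable_\<xi>]; simp)+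
  have [measurable]: "(\<lambda>z. exp_weight (s k) (e k) (snd z) \<gamma>) \<in> borel_measurable (M \<Otimes>\<^sub>M borel)" for \<gamma>
    unfolding exp_weight_def by measurable
  have [measurable]: "(\<lambda>z. \<Sum>\<gamma>\<in>T k. (exp_weight (s k) (e k) (snd z) \<gamma>)\<^sup>2) \<in> borel_measurable (M \<Otimes>\<^sub>M borel)"
    by (intro borel_measurable_sum) measurable
  show ?thesis
    unfolding p(1) pair_coeff_def L2_set_def prod.case by measurable
qed

lemma measurable_det_jacobian:
  "(\<lambda>z. det (jacobian (fst z) (snd z))) \<in> borel_measurable (M \<Otimes>\<^sub>M borel)"
  unfolding det_def jacobian_def normalized_grad_def vec_lambda_beta sum_component vector_scaleR_component
  by (intro borel_measurable_sum borel_measurable_times borel_measurable_prod borel_measurable_const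
      borel_measurable_scaleR measurable_coeff)

lemma borel_measurable_num_system_zeros:
  "(\<lambda>\<omega>. num_elems {w. system \<omega> w = 0}) \<in> borel_measurable M"
proof -
  have "(\<lambda>\<omega>. num_elems {w. (\<Sum>k\<in>UNIV. \<bar>system \<omega> w $ k\<bar>) = 0}) \<in> borel_measurable M"
  proof (rule borel_measurable_num_zeros)
    fix \<omega>
    have "continuous_on UNIV (system \<omega>)"
      using has_derivative_system by (meson continuous_at_imp_continuous_on has_derivative_continuous)
    then show "continuous_on UNIV (\<lambda>w. \<Sum>k\<in>UNIV. \<bar>system \<omega> w $ k\<bar>)"
      by (intro continuous_intros continuous_on_component)
  next
    fix w
    have "(\<lambda>\<omega>. system \<omega> w $ k) \<in> borel_measurable M" for k
      using measurable_compose[OF measurable_Pair2'[of w borel M] measurable_system_component[of k]] by simp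
    then show "(\<lambda>\<omega>. \<Sum>k\<in>UNIV. \<bar>system \<omega> w $ k\<bar>) \<in> borel_measurable M"
      by measurable
  qed
  moreover have "(\<Sum>k\<in>UNIV. \<bar>system \<omega> w $ k\<bar>) = 0 \<longleftrightarrow> system \<omega> w = 0" for \<omega> w
    by (simp add: sum_nonneg_eq_0_iff vec_eq_iff)
  ultimately show ?thesis by simp
qed

text \<open>The factor of the row \<open>k\<close> depends on the coefficients of the \<open>k\<close>-th equation only, so the expectation
of the product is the product of the expectations.\<close>

lemma expected_product_term_le:
  assumes f: "f \<in> PiE UNIV off_diagonal" and \<epsilon>: "0 < \<epsilon>"
  shows "(\<integral>\<^sup>+\<omega>. (\<Prod>k\<in>UNIV. indicator {..<\<epsilon>} \<bar>system \<omega> w $ k\<bar> * ennreal \<bar>coeff \<omega> w k (f k)\<bar>) \<partial>M) \<le>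
    (\<Prod>k\<in>UNIV. ennreal (\<epsilon> / pi) * ennreal (1 / (exp ((difference_matrix f *v w) $ k + ln (s k (fst (f k)) / s k (snd (f k)))) +
       exp (- ((difference_matrix f *v w) $ k + ln (s k (fst (f k)) / s k (snd (f k))))))))"
proof -
  have fk: "f k \<in> off_diagonal k" for k using f by auto
  have row: "(difference_matrix f *v w) $ k = (e k (fst (f k)) - e k (snd (f k))) \<bullet> w" for k
    by (simp add: difference_matrix_def matrix_vector_mult_def inner_vec_def)
  define Y where "Y k x = indicator {..<\<epsilon>} \<bar>normalized_sum (T k) (s k) (e k) (\<lambda>\<alpha>. x (k, \<alpha>)) w\<bar> *
    ennreal \<bar>pair_coeff (T k) (exp_weight (s k) (e k) w) (\<lambda>\<alpha>. x (k, \<alpha>)) (f k)\<bar>" for k and x :: "'n \<times> 'e \<Rightarrow> real"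
  have "indep_vars (\<lambda>k. PiM ({k} \<times> T k) (\<lambda>_. borel)) (\<lambda>k \<omega>. \<lambda>i\<in>{k} \<times> T k. (case i of (k, \<alpha>) \<Rightarrow> \<xi> k \<alpha>) \<omega>) UNIV"
    by (rule indep_vars_restrict[OF indep_\<xi>]) (auto simp: disjoint_family_on_def)
  then have "indep_vars (\<lambda>_. borel) (\<lambda>k \<omega>. Y k (\<lambda>i\<in>{k} \<times> T k. (case i of (k, \<alpha>) \<Rightarrow> \<xi> k \<alpha>) \<omega>)) UNIV"
  proof (rule indep_vars_compose2)
    fix k
    have comp: "(\<lambda>x. x (k, \<alpha>)) \<in> borel_measurable (PiM ({k} \<times> T k) (\<lambda>_. borel :: real measure))" if "\<alpha> \<in> T k" for \<alpha>
      using that by (intro measurable_component_singleton) auto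
    have [measurable]: "(\<lambda>x. \<Sum>\<alpha>\<in>T k. x (k, \<alpha>) * exp_weight (s k) (e k) w \<alpha>) \<in>
        borel_measurable (PiM ({k} \<times> T k) (\<lambda>_. borel :: real measure))"
      by (intro borel_measurable_sum borel_measurable_times comp) auto
    have [measurable]: "(\<lambda>x. x (k, fst (f k))) \<in> borel_measurable (PiM ({k} \<times> T k) (\<lambda>_. borel :: real measure))"
      "(\<lambda>x. x (k, snd (f k))) \<in> borel_measurable (PiM ({k} \<times> T k) (\<lambda>_. borel :: real measure))"
      using fk[of k] by (auto intro!: comp simp: off_diagonal_def)
    show "Y k \<in> borel_measurable (PiM ({k} \<times> T k) (\<lambda>_. borel))"
      unfolding Y_def normalized_sum_def exp_sum_def pair_coeff_def case_prod_unfold by measurable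
  qed
  moreover have "Y k (\<lambda>i\<in>{k} \<times> T k. (case i of (k, \<alpha>) \<Rightarrow> \<xi> k \<alpha>) \<omega>) =
     indicator {..<\<epsilon>} \<bar>system \<omega> w $ k\<bar> * ennreal \<bar>coeff \<omega> w k (f k)\<bar>" for k \<omega>
    using fk[of k]
    by (simp add: Y_def system_def normalized_sum_def exp_sum_def pair_coeff_def case_prod_unfold off_diagonal_def mem_Times_iff)
  ultimately have ind: "indep_vars (\<lambda>_. borel) (\<lambda>k \<omega>. indicator {..<\<epsilon>} \<bar>system \<omega> w $ k\<bar> * ennreal \<bar>coeff \<omega> w k (f k)\<bar>) UNIV"
    by simp
  have "(\<integral>\<^sup>+\<omega>. (\<Prod>k\<in>UNIV. indicator {..<\<epsilon>} \<bar>system \<omega> w $ k\<bar> * ennreal \<bar>coeff \<omega> w k (f k)\<bar>) \<partial>M) =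
    (\<Prod>k\<in>UNIV. \<integral>\<^sup>+\<omega>. indicator {..<\<epsilon>} \<bar>system \<omega> w $ k\<bar> * ennreal \<bar>coeff \<omega> w k (f k)\<bar> \<partial>M)"
    by (rule indep_vars_nn_integral[OF _ ind]) auto
  also have "\<dots> \<le> (\<Prod>k\<in>UNIV. ennreal (\<epsilon> / pi) * ennreal (1 / (exp ((difference_matrix f *v w) $ k + ln (s k (fst (f k)) / s k (snd (f k)))) +
       exp (- ((difference_matrix f *v w) $ k + ln (s k (fst (f k)) / s k (snd (f k))))))))"
    unfolding row by (rule prod_mono_ennreal, rule expected_pair_term_le[OF fk \<epsilon>])
  finally show ?thesis .
qed

text \<open>For each choice \<open>f\<close> of pairs the expectation is an integral over \<open>w\<close> of the determinant of the
differences times a product of functions of the same linear forms; a linear substitution makes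
it independent of \<open>f\<close>.\<close>

lemma expected_kac_integral_le:
  assumes \<epsilon>: "0 < \<epsilon>"
  shows "(\<integral>\<^sup>+\<omega>. \<integral>\<^sup>+w. indicator {w. \<forall>k. \<bar>system \<omega> w $ k\<bar> < \<epsilon>} w * ennreal \<bar>det (jacobian \<omega> w)\<bar> \<partial>lborel \<partial>M)
    \<le> ennreal ((\<epsilon> / 2) ^ CARD('n)) * of_nat (card (PiE UNIV off_diagonal))"
proof -
  interpret pair_sigma_finite M "lborel :: (real, 'n) vec measure" ..
  let ?F = "PiE UNIV off_diagonal"
  let ?t = "\<lambda>f \<omega> w. \<Prod>k\<in>UNIV. indicator {..<\<epsilon>} \<bar>system \<omega> w $ k\<bar> * ennreal \<bar>coeff \<omega> w k (f k)\<bar>"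
  have finF: "finite ?F" by (intro finite_PiE) auto
  have [measurable]: "(\<lambda>z. system (fst z) (snd z) $ k) \<in> borel_measurable (M \<Otimes>\<^sub>M lborel)"
    "(\<lambda>z. det (jacobian (fst z) (snd z))) \<in> borel_measurable (M \<Otimes>\<^sub>M lborel)" for k
    using measurable_system_component measurable_det_jacobian by (simp_all cong: measurable_cong_sets sets_pair_measure_cong)
  have coeff_meas: "(\<lambda>z. coeff (fst z) (snd z) k (f k)) \<in> borel_measurable (M \<Otimes>\<^sub>M lborel)" if "f \<in> ?F" for f k
  proof -
    have "f k \<in> T k \<times> T k" using that by (auto simp: off_diagonal_def PiE_def Pi_def)
    then show ?thesis
      using measurable_coeff by (simp cong: measurable_cong_sets sets_pair_measure_cong)
  qed
  have t_meas: "(\<lambda>z. ?t f (fst z) (snd z)) \<in> borel_measurable (M \<Otimes>\<^sub>M lborel)" if "f \<in> ?F" for f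
    using coeff_meas[OF that, measurable] by measurable
  have t_meas': "(\<lambda>\<omega>. ?t f \<omega> w) \<in> borel_measurable M" if "f \<in> ?F" for f w
    using measurable_compose[OF measurable_Pair2'[of w lborel M] t_meas[OF that]] by simp
  have "(\<integral>\<^sup>+\<omega>. \<integral>\<^sup>+w. indicator {w. \<forall>k. \<bar>system \<omega> w $ k\<bar> < \<epsilon>} w * ennreal \<bar>det (jacobian \<omega> w)\<bar> \<partial>lborel \<partial>M) =
    (\<integral>\<^sup>+w. \<integral>\<^sup>+\<omega>. indicator {w. \<forall>k. \<bar>system \<omega> w $ k\<bar> < \<epsilon>} w * ennreal \<bar>det (jacobian \<omega> w)\<bar> \<partial>M \<partial>lborel)"
  proof (rule Fubini'[symmetric])
    have "(\<lambda>z. (if \<forall>k. \<bar>system (fst z) (snd z) $ k\<bar> < \<epsilon> then 1 else 0) * ennreal \<bar>det (jacobian (fst z) (snd z))\<bar>)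
       \<in> borel_measurable (M \<Otimes>\<^sub>M lborel)"
      by measurable
    then show "(\<lambda>(\<omega>, w). indicator {w. \<forall>k. \<bar>system \<omega> w $ k\<bar> < \<epsilon>} w * ennreal \<bar>det (jacobian \<omega> w)\<bar>)
       \<in> borel_measurable (M \<Otimes>\<^sub>M lborel)"
      by (simp add: case_prod_unfold indicator_def of_bool_def)
  qed
  also have "\<dots> \<le> (\<integral>\<^sup>+w. \<integral>\<^sup>+\<omega>. (\<Sum>f\<in>?F. ennreal \<bar>det (difference_matrix f)\<bar> * ?t f \<omega> w) \<partial>M \<partial>lborel)"
  proof (intro nn_integral_mono)
    fix w \<omega>
    have ind: "indicator {w. \<forall>k. \<bar>system \<omega> w $ k\<bar> < \<epsilon>} w = (\<Prod>k\<in>UNIV. indicator {..<\<epsilon>} \<bar>system \<omega> w $ k\<bar> :: ennreal)"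
      by (auto simp: indicator_def of_bool_def prod_zero_iff)
    have "ennreal \<bar>det (jacobian \<omega> w)\<bar> \<le>
        ennreal (\<Sum>f\<in>?F. (\<Prod>k\<in>UNIV. \<bar>coeff \<omega> w k (f k)\<bar>) * \<bar>det (difference_matrix f)\<bar>)"
      by (intro ennreal_leI abs_det_jacobian_le)
    also have "\<dots> = (\<Sum>f\<in>?F. ennreal \<bar>det (difference_matrix f)\<bar> * (\<Prod>k\<in>UNIV. ennreal \<bar>coeff \<omega> w k (f k)\<bar>))"
      by (simp add: sum_ennreal[symmetric] prod_nonneg ennreal_mult prod_ennreal mult.commute)
    finally have "indicator {w. \<forall>k. \<bar>system \<omega> w $ k\<bar> < \<epsilon>} w * ennreal \<bar>det (jacobian \<omega> w)\<bar> \<le>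
      (\<Prod>k\<in>UNIV. indicator {..<\<epsilon>} \<bar>system \<omega> w $ k\<bar>) *
      (\<Sum>f\<in>?F. ennreal \<bar>det (difference_matrix f)\<bar> * (\<Prod>k\<in>UNIV. ennreal \<bar>coeff \<omega> w k (f k)\<bar>))"
      unfolding ind by (rule mult_left_mono) simp
    also have "\<dots> = (\<Sum>f\<in>?F. ennreal \<bar>det (difference_matrix f)\<bar> * ?t f \<omega> w)"
      by (simp add: sum_distrib_left prod.distrib mult_ac)
    finally show "indicator {w. \<forall>k. \<bar>system \<omega> w $ k\<bar> < \<epsilon>} w * ennreal \<bar>det (jacobian \<omega> w)\<bar> \<le>
      (\<Sum>f\<in>?F. ennreal \<bar>det (difference_matrix f)\<bar> * ?t f \<omega> w)" .
  qed
  also have "\<dots> = (\<integral>\<^sup>+w. (\<Sum>f\<in>?F. ennreal \<bar>det (difference_matrix f)\<bar> * (\<integral>\<^sup>+\<omega>. ?t f \<omega> w \<partial>M)) \<partial>lborel)"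
    by (intro nn_integral_cong, subst nn_integral_sum)
      (auto intro!: borel_measurable_times_ennreal t_meas' sum.cong nn_integral_cmult)
  also have "\<dots> = (\<Sum>f\<in>?F. \<integral>\<^sup>+w. ennreal \<bar>det (difference_matrix f)\<bar> * (\<integral>\<^sup>+\<omega>. ?t f \<omega> w \<partial>M) \<partial>lborel)"
  proof (rule nn_integral_sum)
    fix f assume f: "f \<in> ?F"
    have "(\<lambda>z. ?t f (snd z) (fst z)) \<in> borel_measurable (lborel \<Otimes>\<^sub>M M)"
      using measurable_compose[OF measurable_pair_swap' t_meas[OF f]] by (simp add: case_prod_unfold)
    then have "(\<lambda>w. \<integral>\<^sup>+\<omega>. ?t f \<omega> w \<partial>M) \<in> borel_measurable lborel"
      by (intro sigma_finite_measure.borel_measurable_nn_integral[OF prob_space_imp_sigma_finite[OF prob_space_axioms]])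
        (simp add: case_prod_unfold)
    then show "(\<lambda>w. ennreal \<bar>det (difference_matrix f)\<bar> * (\<integral>\<^sup>+\<omega>. ?t f \<omega> w \<partial>M)) \<in> borel_measurable lborel"
      by (intro borel_measurable_times_ennreal borel_measurable_const)
  qed
  also have "\<dots> \<le> (\<Sum>f\<in>?F. ennreal ((\<epsilon> / 2) ^ CARD('n)))"
  proof (rule sum_mono)
    fix f assume f: "f \<in> ?F"
    let ?d = "\<lambda>w. \<Prod>k\<in>UNIV. ennreal (1 / (exp ((difference_matrix f *v w) $ k + ln (s k (fst (f k)) / s k (snd (f k)))) +
       exp (- ((difference_matrix f *v w) $ k + ln (s k (fst (f k)) / s k (snd (f k)))))))"
    show "(\<integral>\<^sup>+w. ennreal \<bar>det (difference_matrix f)\<bar> * (\<integral>\<^sup>+\<omega>. ?t f \<omega> w \<partial>M) \<partial>lborel) \<le> ennreal ((\<epsilon> / 2) ^ CARD('n))"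
    proof (cases "det (difference_matrix f) = 0")
      case False
      have "(\<integral>\<^sup>+w. ennreal \<bar>det (difference_matrix f)\<bar> * (\<integral>\<^sup>+\<omega>. ?t f \<omega> w \<partial>M) \<partial>lborel) \<le>
        (\<integral>\<^sup>+w. ennreal ((\<epsilon> / pi) ^ CARD('n)) * (ennreal \<bar>det (difference_matrix f)\<bar> * ?d w) \<partial>lborel)"
      proof (rule nn_integral_mono)
        fix w
        have "(\<integral>\<^sup>+\<omega>. ?t f \<omega> w \<partial>M) \<le> ennreal ((\<epsilon> / pi) ^ CARD('n)) * ?d w"
          using expected_product_term_le[OF f \<epsilon>, of w] \<epsilon> by (simp add: prod.distrib ennreal_power)
        then show "ennreal \<bar>det (difference_matrix f)\<bar> * (\<integral>\<^sup>+\<omega>. ?t f \<omega> w \<partial>M) \<le>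
          ennreal ((\<epsilon> / pi) ^ CARD('n)) * (ennreal \<bar>det (difference_matrix f)\<bar> * ?d w)"
          by (subst mult.left_commute) (rule mult_left_mono, auto)
      qed
      also have "\<dots> = ennreal ((\<epsilon> / pi) ^ CARD('n)) * (\<integral>\<^sup>+w. ennreal \<bar>det (difference_matrix f)\<bar> * ?d w \<partial>lborel)"
      proof (rule nn_integral_cmult)
        have [measurable]: "(\<lambda>w. (difference_matrix f *v w) $ k) \<in> borel_measurable borel" for k
          by (intro borel_measurable_continuous_onI continuous_on_component linear_continuous_on matrix_vector_mul_bounded_linear)
        show "(\<lambda>w. ennreal \<bar>det (difference_matrix f)\<bar> * ?d w) \<in> borel_measurable lborel"
          by measurable
      qed
      also have "\<dots> = ennreal ((\<epsilon> / pi) ^ CARD('n)) * ennreal ((pi / 2) ^ CARD('n))"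
        by (simp only: nn_integral_det_prod_half_sech[OF False])
      also have "\<dots> = ennreal ((\<epsilon> / 2) ^ CARD('n))"
        using \<epsilon> by (simp add: ennreal_mult[symmetric] power_mult_distrib[symmetric])
      finally show ?thesis .
    qed simp
  qed
  also have "\<dots> = ennreal ((\<epsilon> / 2) ^ CARD('n)) * of_nat (card ?F)"
    by (simp add: mult.commute)
  finally show ?thesis .
qed

text \<open>Fatou's lemma exchanges the expectation with the limit inferior in Kac's counting bound, and the
resulting bound no longer depends on \<open>\<epsilon>\<close>: the factor \<open>(\<epsilon>/2)^n\<close> divided by the cube volume
\<open>(2 \<epsilon>)^n\<close> is \<open>1/4^n\<close>.\<close>

lemma expected_num_zeros_le:
  "(\<integral>\<^sup>+\<omega>. num_elems {w. system \<omega> w = 0} \<partial>M) \<le>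
    ennreal (1 / 4 ^ CARD('n) * (\<Prod>k\<in>UNIV. real (card (T k)) * (real (card (T k)) - 1)))"
proof -
  define \<epsilon> where "\<epsilon> j = inverse (real (Suc j))" for j
  have \<epsilon>: "0 < \<epsilon> j" for j by (simp add: \<epsilon>_def)
  have lim: "\<epsilon> \<longlonglongrightarrow> 0" unfolding \<epsilon>_def by (rule LIMSEQ_inverse_real_of_nat)
  let ?I = "\<lambda>j \<omega>. \<integral>\<^sup>+w. indicator {w. \<forall>k. \<bar>system \<omega> w $ k\<bar> < \<epsilon> j} w * ennreal \<bar>det (jacobian \<omega> w)\<bar> \<partial>lborel"
  let ?V = "\<lambda>j. ennreal ((2 * \<epsilon> j) ^ CARD('n))"
  let ?C = "of_nat (card (PiE UNIV off_diagonal)) :: ennreal"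
  have I_meas: "?I j \<in> borel_measurable M" for j
  proof -
    have [measurable]: "(\<lambda>z. system (fst z) (snd z) $ k) \<in> borel_measurable (M \<Otimes>\<^sub>M lborel)"
      "(\<lambda>z. det (jacobian (fst z) (snd z))) \<in> borel_measurable (M \<Otimes>\<^sub>M lborel)" for k
      using measurable_system_component measurable_det_jacobian by (simp_all cong: measurable_cong_sets sets_pair_measure_cong)
    have "(\<lambda>z. (if \<forall>k. \<bar>system (fst z) (snd z) $ k\<bar> < \<epsilon> j then 1 else 0) * ennreal \<bar>det (jacobian (fst z) (snd z))\<bar>)
       \<in> borel_measurable (M \<Otimes>\<^sub>M lborel)"
      by measurable
    then show ?thesis
      by (intro lborel.borel_measurable_nn_integral) (simp add: case_prod_unfold indicator_def of_bool_def)
  qed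
  have "(\<integral>\<^sup>+\<omega>. num_elems {w. system \<omega> w = 0} \<partial>M) \<le> (\<integral>\<^sup>+\<omega>. liminf (\<lambda>j. ?I j \<omega> / ?V j) \<partial>M)"
  proof (rule nn_integral_mono_AE)
    show "AE \<omega> in M. num_elems {w. system \<omega> w = 0} \<le> liminf (\<lambda>j. ?I j \<omega> / ?V j)"
      using AE_zeros_nondegenerate
    proof eventually_elim
      case (elim \<omega>)
      show ?case
        by (rule kac_counting[OF has_derivative_system continuous_jacobian]) (use elim \<epsilon> lim in auto)
    qed
  qed
  also have "\<dots> \<le> liminf (\<lambda>j. \<integral>\<^sup>+\<omega>. ?I j \<omega> / ?V j \<partial>M)"
    by (rule nn_integral_liminf) (use I_meas in measurable)
  also have "\<dots> \<le> liminf (\<lambda>j::nat. ennreal ((1 / 4) ^ CARD('n)) * ?C)"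
  proof (rule Liminf_mono, rule always_eventually, rule allI)
    fix j
    have "(\<integral>\<^sup>+\<omega>. ?I j \<omega> / ?V j \<partial>M) = (\<integral>\<^sup>+\<omega>. ?I j \<omega> \<partial>M) / ?V j"
      by (rule nn_integral_divide) (rule I_meas)
    also have "\<dots> \<le> (ennreal ((\<epsilon> j / 2) ^ CARD('n)) * ?C) / ?V j"
      by (rule divide_right_mono_ennreal) (rule expected_kac_integral_le[OF \<epsilon>])
    also have "\<dots> = ennreal ((\<epsilon> j / 2) ^ CARD('n)) / ?V j * ?C"
      by (simp add: divide_ennreal_def mult_ac)
    also have "ennreal ((\<epsilon> j / 2) ^ CARD('n)) / ?V j = ennreal ((1 / 4) ^ CARD('n))"
    proof -
      have "(\<epsilon> j / 2) ^ CARD('n) / (2 * \<epsilon> j) ^ CARD('n) = (\<epsilon> j / 2 / (2 * \<epsilon> j)) ^ CARD('n)"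
        by (rule power_divide[symmetric])
      also have "\<epsilon> j / 2 / (2 * \<epsilon> j) = 1 / 4" using \<epsilon>[of j] by simp
      finally show ?thesis using \<epsilon>[of j] by (subst divide_ennreal) auto
    qed
    finally show "(\<integral>\<^sup>+\<omega>. ?I j \<omega> / ?V j \<partial>M) \<le> ennreal ((1 / 4) ^ CARD('n)) * ?C" .
  qed
  also have "\<dots> = ennreal ((1 / 4) ^ CARD('n)) * ?C"
    by (simp add: Liminf_const)
  also have "\<dots> = ennreal ((1 / 4) ^ CARD('n) * real (card (PiE UNIV off_diagonal)))"
    by (simp add: ennreal_mult ennreal_of_nat_eq_real_of_nat)
  also have "real (card (PiE UNIV off_diagonal)) = (\<Prod>k\<in>UNIV. real (card (T k)) * (real (card (T k)) - 1))"
    by (simp add: card_PiE card_off_diagonal)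
  finally show ?thesis by (simp add: power_one_over)
qed

end

section \<open>Arbitrary finite index types\<close>

text \<open>A well-ordered finite type of the same cardinality as a given finite type. It allows results
on \<open>real ^ 'n\<close> that rely on an order of the coordinates to be transferred to every finite index type.\<close>

typedef (overloaded) 'n ordered_copy = "{..<CARD('n::finite)}"
  by (rule exI[of _ 0]) (simp add: zero_less_card_finite)

instantiation ordered_copy :: (finite) wellorder
begin

definition less_eq_ordered_copy :: "'a ordered_copy \<Rightarrow> 'a ordered_copy \<Rightarrow> bool" where
  "x \<le> y \<longleftrightarrow> Rep_ordered_copy x \<le> Rep_ordered_copy y"

definition less_ordered_copy :: "'a ordered_copy \<Rightarrow> 'a ordered_copy \<Rightarrow> bool" where
  "x < y \<longleftrightarrow> Rep_ordered_copy x < Rep_ordered_copy y"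

instance
proof
  fix P :: "'a ordered_copy \<Rightarrow> bool" and a
  assume step: "\<And>x. (\<And>y. y < x \<Longrightarrow> P y) \<Longrightarrow> P x"
  show "P a"
    by (induction a rule: measure_induct_rule[of Rep_ordered_copy])
      (use step in \<open>auto simp: less_ordered_copy_def\<close>)
qed (auto simp: less_eq_ordered_copy_def less_ordered_copy_def Rep_ordered_copy_inject)

end

instance ordered_copy :: (finite) finite
proof
  have "(UNIV :: 'a ordered_copy set) = Abs_ordered_copy ` {..<CARD('a)}"
    using type_definition.Abs_image[OF type_definition_ordered_copy] by (rule sym)
  then show "finite (UNIV :: 'a ordered_copy set)"
    by (metis finite_imageI finite_lessThan)
qed

lemma ex_bij_ordered_copy: "\<exists>\<tau> :: 'n::finite ordered_copy \<Rightarrow> 'n. bij \<tau>"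
proof -
  have "card (UNIV :: 'n ordered_copy set) = CARD('n)"
    by (simp add: type_definition.card[OF type_definition_ordered_copy])
  then show ?thesis
    using finite_same_card_bij[of "UNIV :: 'n ordered_copy set" "UNIV :: 'n set"] by simp
qed

lemma num_elems_bij_betw:
  assumes "bij_betw h S S'"
  shows "num_elems S = num_elems S'"
proof (cases "finite S")
  case True
  then show ?thesis
    using bij_betw_finite[OF assms] bij_betw_same_card[OF assms]
    by (simp add: num_elems_def emeasure_count_space)
next
  case False
  then show ?thesis
    using bij_betw_finite[OF assms] by (simp add: num_elems_def emeasure_count_space)
qed

theorem theorem1p1:
  fixes M :: "'w measure"
    and A :: "'n::finite \<Rightarrow> (real ^ 'n) set"
    and F :: "'n \<Rightarrow> real ^ 'n \<Rightarrow> 'w \<Rightarrow> real"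
    and \<sigma> :: "'n \<Rightarrow> real ^ 'n \<Rightarrow> real"
  assumes "prob_space M"
    and "\<And>k. finite (A k)"
    and "\<And>k. A k \<noteq> {}"
    and "\<And>k \<alpha>. \<alpha> \<in> A k \<Longrightarrow> 0 < \<sigma> k \<alpha>"
    and "\<And>k \<alpha>. \<alpha> \<in> A k \<Longrightarrow> distributed M lborel (F k \<alpha>) (normal_density 0 (\<sigma> k \<alpha>))"
    and "prob_space.indep_vars M (\<lambda>_. borel) (\<lambda>(k, \<alpha>). F k \<alpha>) (SIGMA k:UNIV. A k)"
  shows "(\<lambda>\<omega>. num_elems (pos_zeros (\<lambda>k. fewnomial (A k) (\<lambda>\<alpha>. F k \<alpha> \<omega>)))) \<in> borel_measurable M
    \<and> (\<integral>\<^sup>+ \<omega>. num_elems (pos_zeros (\<lambda>k. fewnomial (A k) (\<lambda>\<alpha>. F k \<alpha> \<omega>))) \<partial>M)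
      \<le> ennreal (1 / 4 ^ CARD('n) * (\<Prod>k\<in>UNIV. real (card (A k)) * (real (card (A k)) - 1)))"
proof -
  interpret prob_space M by fact
  obtain \<tau> :: "'n ordered_copy \<Rightarrow> 'n" where \<tau>: "bij \<tau>"
    using ex_bij_ordered_copy by blast
  define T where "T k = A (\<tau> k)" for k
  define s where "s k = \<sigma> (\<tau> k)" for k
  define e where "e k \<alpha> = (\<chi> i. \<alpha> $ \<tau> i)" for k :: "'n ordered_copy" and \<alpha> :: "real ^ 'n"
  define \<xi> where "\<xi> k \<alpha> \<omega> = F (\<tau> k) \<alpha> \<omega> / \<sigma> (\<tau> k) \<alpha>" for k \<alpha> \<omega>
  interpret gaussian_exp_system M T s e \<xi>
  proof
    show "finite (T k)" "T k \<noteq> {}" for k using assms by (auto simp: T_def)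
    show "0 < s k \<alpha>" if "\<alpha> \<in> T k" for k \<alpha> using assms that by (auto simp: T_def s_def)
    show "distributed M lborel (\<xi> k \<alpha>) std_normal_density" if "\<alpha> \<in> T k" for k \<alpha>
    proof -
      have "\<alpha> \<in> A (\<tau> k)" using that by (simp add: T_def)
      then show ?thesis
        using normal_standard_normal_convert[of "\<sigma> (\<tau> k) \<alpha>" "F (\<tau> k) \<alpha>" 0] assms(4,5) by (simp add: \<xi>_def[abs_def])
    qed
    have "indep_vars (\<lambda>_. borel) (\<lambda>i. (\<lambda>(k, \<alpha>). F k \<alpha>) (map_prod \<tau> id i)) (SIGMA k:UNIV. T k)"
      by (rule indep_vars_reindex[OF assms(6)])
        (use \<tau> in \<open>auto simp: T_def inj_on_def bij_def\<close>)
    from indep_vars_compose2[OF this, of "\<lambda>i x. x / \<sigma> (\<tau> (fst i)) (snd i)" "\<lambda>_. borel"]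
    show "indep_vars (\<lambda>_. borel) (\<lambda>(k, \<alpha>). \<xi> k \<alpha>) (SIGMA k:UNIV. T k)"
      by (simp add: case_prod_unfold \<xi>_def[abs_def])
  qed
  have zeros: "num_elems (pos_zeros (\<lambda>k. fewnomial (A k) (\<lambda>\<alpha>. F k \<alpha> \<omega>))) = num_elems {w. system \<omega> w = 0}" for \<omega>
  proof (rule num_elems_bij_betw[symmetric])
    let ?X = "\<lambda>w. \<chi> i. exp (w $ inv \<tau> i)"
    have monomial: "power_product (?X w) \<alpha> = exp (e k \<alpha> \<bullet> w)" for w k \<alpha>
    proof -
      have "power_product (?X w) \<alpha> = exp (\<Sum>i\<in>UNIV. \<alpha> $ i * w $ inv \<tau> i)"
        by (simp add: power_product_def powr_def exp_sum)
      also have "(\<Sum>i\<in>UNIV. \<alpha> $ i * w $ inv \<tau> i) = (\<Sum>j\<in>UNIV. \<alpha> $ \<tau> j * w $ j)"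
        by (rule sum.reindex_bij_betw[OF \<tau>, symmetric, THEN trans]) (use \<tau> in \<open>simp add: bij_is_inj\<close>)
      finally show ?thesis by (simp add: e_def inner_vec_def)
    qed
    have system_iff: "system \<omega> w = 0 \<longleftrightarrow> (\<forall>k. fewnomial (A k) (\<lambda>\<alpha>. F k \<alpha> \<omega>) (?X w) = 0)" for w
    proof -
      have "Defs.fewnomial (A (\<tau> k)) (\<lambda>\<alpha>. F (\<tau> k) \<alpha> \<omega>) (?X w) = exp_sum (T k) (s k) (e k) (\<lambda>\<alpha>. \<xi> k \<alpha> \<omega>) w" for k
        unfolding fewnomial_def exp_sum_def T_def
        by (intro sum.cong refl)
          (use assms(4)[of _ "\<tau> k"] in \<open>force simp: monomial[of _ _ k] exp_weight_def s_def \<xi>_def\<close>)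
      then show ?thesis
        unfolding system_eq_0_iff using \<tau> by (metis bij_pointE)
    qed
    show "bij_betw ?X {w. system \<omega> w = 0} (pos_zeros (\<lambda>k. fewnomial (A k) (\<lambda>\<alpha>. F k \<alpha> \<omega>)))"
    proof (rule bij_betwI[where g="\<lambda>x. \<chi> j. ln (x $ \<tau> j)"])
      show "?X \<in> {w. system \<omega> w = 0} \<rightarrow> pos_zeros (\<lambda>k. fewnomial (A k) (\<lambda>\<alpha>. F k \<alpha> \<omega>))"
        by (auto simp: pos_zeros_def pos_orthant_def system_iff)
      show inv1: "(\<chi> j. ln (?X w $ \<tau> j)) = w" for w :: "real ^ 'n ordered_copy"
        using \<tau> by (simp add: vec_eq_iff bij_is_inj)
      have inv2: "?X (\<chi> j. ln (x $ \<tau> j)) = x" if "x \<in> pos_orthant" for x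
        using \<tau> that by (simp add: vec_eq_iff bij_is_surj surj_f_inv_f pos_orthant_def)
      then show "?X (\<chi> j. ln (x $ \<tau> j)) = x" if "x \<in> pos_zeros (\<lambda>k. fewnomial (A k) (\<lambda>\<alpha>. F k \<alpha> \<omega>))" for x
        using that by (simp add: pos_zeros_def)
      show "(\<lambda>x. \<chi> j. ln (x $ \<tau> j)) \<in> pos_zeros (\<lambda>k. fewnomial (A k) (\<lambda>\<alpha>. F k \<alpha> \<omega>)) \<rightarrow> {w. system \<omega> w = 0}"
        using inv2 by (auto simp: pos_zeros_def system_iff)
    qed
  qed
  have card: "CARD('n ordered_copy) = CARD('n)"
    using bij_betw_same_card[OF \<tau>] .
  have "(\<Prod>k\<in>UNIV. real (card (T k)) * (real (card (T k)) - 1)) =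
    (\<Prod>k\<in>UNIV. real (card (A k)) * (real (card (A k)) - 1))"
    unfolding T_def by (rule prod.reindex_bij_betw[OF \<tau>])
  then show ?thesis
    using borel_measurable_num_system_zeros expected_num_zeros_le
    unfolding zeros card by simp
qed

end
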